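(* Let $I=\mathbb Z^n$, let $(X_i)_{i\in\mathbb Z^n}$ be random variables with joint law $\Pr$, and suppose that for all $i,j\in\mathbb Z^n$ one has $\{X_i:X_j\}_*\le\epsilon(j-i)$ for some symmetric function $\epsilon:\mathbb Z^n\to[0,1]$ such that $\epsilon(z)<1$ as soon as $z\ne0$. If $\sum_{z\in\mathbb Z^n}\epsilon(z)<\infty$, then the spectral gap of the Glauber dynamics associated to $\Pr$ is positive, i.e. there is $\lambda>0$ such that $\mathcal E(f,f)\ge\lambda\operatorname{Var}(f)$ for all real square-integrable $f$.
   Context: Symmetric means $\epsilon(-z)=\epsilon(z)$. Glauber dynamics: the Markov process on the state space of $(X_i)_{i\in I}$ where each $i\in I$ carries an independent rate-$1$ Poisson clock and, when clock $i$ rings, only $X_i$ is resampled, according to its conditional law under $\Pr$ given $(X_j)_{j\ne i}$. Its energy (Dirichlet form) is $$\mathcal E(f,f)=\sum_{i\in I}\mathbf E\big[\operatorname{Var}(f\,|\,(X_j)_{j\in I\setminus\{i\}})\big]\in[0,+\infty],\qquad f\in L^2(\Pr).$$ Subjective correlation: for $\sigma$-algebras $\mathcal F,\mathcal G,\mathcal H$, $\{\mathcal F:\mathcal G\}_{\mathcal H}$ is the smallest $\epsilon\in[0,1]$ such that $|\mathbf E[fg]|\le\epsilon\operatorname{sd}(f)\operatorname{sd}(g)$ for all real square-integrable $f$ ($\mathcal F\vee\mathcal H$-measurable) and $g$ ($\mathcal G\vee\mathcal H$-measurable) with $\mathbf E[f|\mathcal H]=\mathbf E[g|\mathcal H]=0$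 a.s. ($\operatorname{sd}$ is the standard deviation). For the system $(X_k)_{k\in\mathbb Z^n}$, $$\{X_i:X_j\}_*=\sup_{K\subset\mathbb Z^n}\{\sigma(X_i):\sigma(X_j)\}_{\sigma((X_k)_{k\in K})}.$$ *)

theory Defs
  imports "HOL-Probability.Probability"
begin

definition sd :: "'a measure \<Rightarrow> ('a \<Rightarrow> real) \<Rightarrow> real" where
  "sd M f = sqrt (prob_space.variance M f)"

text \<open>Sub-\<open>\<sigma>\<close>-algebras are represented, as in the library's conditional expectations, by
  measures of which only the space and the measurable sets matter.\<close>

definition join_alg :: "'a measure \<Rightarrow> 'a measure \<Rightarrow> 'a measure" where
  "join_alg F G = sigma (space F) (sets F \<union> sets G)"

text \<open>The \<open>\<sigma>\<close>-algebra generated by \<open>(X k)\<close> for \<open>k \<in> K\<close>, each \<open>X k\<close> being valued in \<open>N k\<close>.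
  A supremum of measures is not used here, since for empty \<open>K\<close> its underlying space would be
  empty instead of \<open>space M\<close>.\<close>

definition alg_of :: "'a measure \<Rightarrow> ('i \<Rightarrow> 'b measure) \<Rightarrow> ('i \<Rightarrow> 'a \<Rightarrow> 'b) \<Rightarrow> 'i set \<Rightarrow> 'a measure" where
  "alg_of M N X K = sigma (space M) (\<Union>k\<in>K. sets (vimage_algebra (space M) (X k) (N k)))"

definition corr_bound ::
    "'a measure \<Rightarrow> 'a measure \<Rightarrow> 'a measure \<Rightarrow> 'a measure \<Rightarrow> real \<Rightarrow> bool" where
  "corr_bound M F G H e \<longleftrightarrow>
    (\<forall>f g. f \<in> borel_measurable (join_alg F H) \<longrightarrow> g \<in> borel_measurable (join_alg G H) \<longrightarrow>
       integrable M (\<lambda>\<omega>. (f \<omega>)\<^sup>2) \<longrightarrow> integrable M (\<lambda>\<omega>. (g \<omega>)\<^sup>2) \<longrightarrow>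
       (AE \<omega> in M. real_cond_exp M H f \<omega> = 0) \<longrightarrow> (AE \<omega> in M. real_cond_exp M H g \<omega> = 0) \<longrightarrow>
       \<bar>\<integral>\<omega>. f \<omega> * g \<omega> \<partial>M\<bar> \<le> e * sd M f * sd M g)"

text \<open>The subjective correlation \<open>{F : G}\<^sub>H\<close>; lemma \<open>subj_corr_least\<close> below shows
  that the infimum is attained.\<close>

definition subj_corr :: "'a measure \<Rightarrow> 'a measure \<Rightarrow> 'a measure \<Rightarrow> 'a measure \<Rightarrow> real" where
  "subj_corr M F G H = Inf {e \<in> {0..1}. corr_bound M F G H e}"

definition corr_star ::
    "'a measure \<Rightarrow> ('i \<Rightarrow> 'b measure) \<Rightarrow> ('i \<Rightarrow> 'a \<Rightarrow> 'b) \<Rightarrow> 'i \<Rightarrow> 'i \<Rightarrow> real" where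
  "corr_star M N X i j =
    (SUP K. subj_corr M (vimage_algebra (space M) (X i) (N i))
                        (vimage_algebra (space M) (X j) (N j)) (alg_of M N X K))"

definition cond_var :: "'a measure \<Rightarrow> 'a measure \<Rightarrow> ('a \<Rightarrow> real) \<Rightarrow> 'a \<Rightarrow> real" where
  "cond_var M F f = real_cond_exp M F (\<lambda>\<omega>. (f \<omega> - real_cond_exp M F f \<omega>)\<^sup>2)"

text \<open>The Dirichlet form \<open>\<E>(f, f)\<close> of the Glauber dynamics for the system \<open>X\<close>, indexed by a whole
  type. Here \<open>f\<close> is a function on the state space, evaluated along \<open>X\<close>.\<close>

definition glauber_energy ::
    "'a measure \<Rightarrow> ('i \<Rightarrow> 'b measure) \<Rightarrow> ('i \<Rightarrow> 'a \<Rightarrow> 'b) \<Rightarrow> (('i \<Rightarrow> 'b) \<Rightarrow> real) \<Rightarrow> ennreal" where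
  "glauber_energy M N X f =
    (\<Sum>\<^sub>\<infinity>i. ennreal (\<integral>\<omega>. cond_var M (alg_of M N X (UNIV - {i})) (\<lambda>\<omega>. f (\<lambda>k. X k \<omega>)) \<omega> \<partial>M))"

lemma space_join_alg [simp]: "space (join_alg F G) = space F"
  by (simp add: join_alg_def space_measure_of_conv)

lemma join_alg_borel_measurable:
  assumes F: "subalgebra M F" and H: "subalgebra M H" and f: "f \<in> borel_measurable (join_alg F H)"
  shows "f \<in> borel_measurable M"
proof -
  have sp: "space F = space M" "space H = space M"
    and s: "sets F \<subseteq> sets M" "sets H \<subseteq> sets M"
    using F H by (auto simp: subalgebra_def)
  have "sets F \<union> sets H \<subseteq> Pow (space M)"
    using s sets.sets_into_space by blast
  then have "sets (join_alg F H) = sigma_sets (space M) (sets F \<union> sets H)"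
    by (simp add: join_alg_def sp)
  also have "\<dots> \<subseteq> sets M"
    using s by (intro sets.sigma_sets_subset) auto
  finally have "subalgebra M (join_alg F H)"
    by (simp add: subalgebra_def sp)
  then show ?thesis
    using f measurable_from_subalg by blast
qed

lemma subalgebra_vimage_algebra:
  assumes "X \<in> measurable M N"
  shows "subalgebra M (vimage_algebra (space M) X N)"
  using assms measurable_space[OF assms] 
  by (auto simp: subalgebra_def sets_vimage_algebra2 measurable_sets)

lemma subalgebra_alg_of:
  assumes "\<And>k. k \<in> K \<Longrightarrow> X k \<in> measurable M (N k)"
  shows "subalgebra M (alg_of M N X K)"
proof -
  let ?A = "\<Union>k\<in>K. sets (vimage_algebra (space M) (X k) (N k))"
  have A: "?A \<subseteq> sets M"
    using subalgebra_vimage_algebra[OF assms] by (auto simp: subalgebra_def)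
  then have "?A \<subseteq> Pow (space M)"
    using sets.sets_into_space by blast
  then show ?thesis
    using sets.sigma_sets_subset[OF A] by (simp add: subalgebra_def alg_of_def)
qed

lemma subj_corr_least:
  assumes M: "prob_space M" and F: "subalgebra M F" and G: "subalgebra M G" and H: "subalgebra M H"
  shows "subj_corr M F G H \<in> {0..1}" and "corr_bound M F G H (subj_corr M F G H)"
    and "\<And>e. e \<in> {0..1} \<Longrightarrow> corr_bound M F G H e \<Longrightarrow> subj_corr M F G H \<le> e"
proof -
  interpret prob_space M by fact
  interpret finite_measure_subalgebra M H
    by unfold_locales fact
  let ?S = "{e \<in> {0..1}. corr_bound M F G H e}"
  have var0: "variance f = (\<integral>\<omega>. (f \<omega>)\<^sup>2 \<partial>M)"
    if f: "f \<in> borel_measurable M" "integrable M (\<lambda>\<omega>. (f \<omega>)\<^sup>2)"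
      and 0: "AE \<omega> in M. real_cond_exp M H f \<omega> = 0" for f
  proof -
    have "integrable M f"
      using square_integrable_imp_integrable[OF f] .
    then have "expectation f = (\<integral>\<omega>. real_cond_exp M H f \<omega> \<partial>M)"
      using real_cond_exp_int(2) by simp
    also have "\<dots> = 0"
      using integral_cong_AE[of "real_cond_exp M H f" M "\<lambda>_. 0"] 0 by simp
    finally show ?thesis by simp
  qed
  have "corr_bound M F G H 1"
    unfolding corr_bound_def
  proof (intro allI impI)
    fix f g
    assume fm: "f \<in> borel_measurable (join_alg F H)" and gm: "g \<in> borel_measurable (join_alg G H)"
      and f2: "integrable M (\<lambda>\<omega>. (f \<omega>)\<^sup>2)" and g2: "integrable M (\<lambda>\<omega>. (g \<omega>)\<^sup>2)"
      and f0: "AE \<omega> in M. real_cond_exp M H f \<omega> = 0" and g0: "AE \<omega> in M. real_cond_exp M H g \<omega> = 0"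
    have [measurable]: "f \<in> borel_measurable M" "g \<in> borel_measurable M"
      using join_alg_borel_measurable fm gm F G H by blast+
    have "ennreal ((\<integral>\<omega>. \<bar>f \<omega> * g \<omega>\<bar> \<partial>M)\<^sup>2)
        \<le> ennreal ((\<integral>\<omega>. (f \<omega>)\<^sup>2 \<partial>M) * (\<integral>\<omega>. (g \<omega>)\<^sup>2 \<partial>M))"
    proof -
      have "integrable M (\<lambda>\<omega>. f \<omega> * g \<omega>)"
      proof (rule Bochner_Integration.integrable_bound[of _ "\<lambda>\<omega>. (f \<omega>)\<^sup>2 + (g \<omega>)\<^sup>2"])
        show "AE \<omega> in M. norm (f \<omega> * g \<omega>) \<le> norm ((f \<omega>)\<^sup>2 + (g \<omega>)\<^sup>2)"
        proof (rule AE_I2)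
          fix \<omega>
          have "2 * (\<bar>f \<omega>\<bar> * \<bar>g \<omega>\<bar>) \<le> (f \<omega>)\<^sup>2 + (g \<omega>)\<^sup>2"
            using sum_squares_bound[of "\<bar>f \<omega>\<bar>" "\<bar>g \<omega>\<bar>"] by simp
          moreover have "0 \<le> \<bar>f \<omega>\<bar> * \<bar>g \<omega>\<bar>" by simp
          ultimately show "norm (f \<omega> * g \<omega>) \<le> norm ((f \<omega>)\<^sup>2 + (g \<omega>)\<^sup>2)"
            unfolding real_norm_def abs_mult by linarith
        qed
      qed (use f2 g2 in auto)
      then have "ennreal ((\<integral>\<omega>. \<bar>f \<omega> * g \<omega>\<bar> \<partial>M)\<^sup>2) = (\<integral>\<^sup>+\<omega>. ennreal \<bar>f \<omega>\<bar> * ennreal \<bar>g \<omega>\<bar> \<partial>M)\<^sup>2"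
        by (simp add: ennreal_mult[symmetric] abs_mult[symmetric] nn_integral_eq_integral
            ennreal_power[symmetric])
      also have "\<dots> \<le> (\<integral>\<^sup>+\<omega>. (ennreal \<bar>f \<omega>\<bar>)\<^sup>2 \<partial>M) * (\<integral>\<^sup>+\<omega>. (ennreal \<bar>g \<omega>\<bar>)\<^sup>2 \<partial>M)"
        by (rule Cauchy_Schwarz_nn_integral) auto
      also have "\<dots> = ennreal ((\<integral>\<omega>. (f \<omega>)\<^sup>2 \<partial>M) * (\<integral>\<omega>. (g \<omega>)\<^sup>2 \<partial>M))"
        using f2 g2 by (simp add: ennreal_power nn_integral_eq_integral ennreal_mult)
      finally show ?thesis .
    qed
    then have "(\<integral>\<omega>. \<bar>f \<omega> * g \<omega>\<bar> \<partial>M)\<^sup>2 \<le> (\<integral>\<omega>. (f \<omega>)\<^sup>2 \<partial>M) * (\<integral>\<omega>. (g \<omega>)\<^sup>2 \<partial>M)"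
      by (simp add: ennreal_le_iff)
    moreover have "(\<integral>\<omega>. f \<omega> * g \<omega> \<partial>M)\<^sup>2 \<le> (\<integral>\<omega>. \<bar>f \<omega> * g \<omega>\<bar> \<partial>M)\<^sup>2"
      by (simp add: abs_le_square_iff[symmetric] integral_abs_bound)
    ultimately have "(\<integral>\<omega>. f \<omega> * g \<omega> \<partial>M)\<^sup>2 \<le> (\<integral>\<omega>. (f \<omega>)\<^sup>2 \<partial>M) * (\<integral>\<omega>. (g \<omega>)\<^sup>2 \<partial>M)"
      by simp
    then have "sqrt ((\<integral>\<omega>. f \<omega> * g \<omega> \<partial>M)\<^sup>2) \<le> sqrt (variance f * variance g)"
      unfolding var0[OF \<open>f \<in> borel_measurable M\<close> f2 f0] var0[OF \<open>g \<in> borel_measurable M\<close> g2 g0]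
      by (rule real_sqrt_le_mono)
    then show "\<bar>\<integral>\<omega>. f \<omega> * g \<omega> \<partial>M\<bar> \<le> 1 * sd M f * sd M g"
      by (simp add: sd_def real_sqrt_mult)
  qed
  then have one: "1 \<in> ?S" by simp
  have bdd: "bdd_below ?S" by (rule bdd_belowI[of _ 0]) auto
  show least: "\<And>e. e \<in> {0..1} \<Longrightarrow> corr_bound M F G H e \<Longrightarrow> subj_corr M F G H \<le> e"
    unfolding subj_corr_def by (rule cInf_lower[OF _ bdd]) auto
  show "subj_corr M F G H \<in> {0..1}"
  proof -
    have "0 \<le> Inf ?S" using one by (intro cInf_greatest) auto
    moreover have "Inf ?S \<le> 1" by (rule cInf_lower[OF one bdd])
    ultimately show ?thesis unfolding subj_corr_def atLeastAtMost_iff by blast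
  qed
  show "corr_bound M F G H (subj_corr M F G H)"
    unfolding corr_bound_def
  proof (intro allI impI)
    fix f g
    assume fg: "f \<in> borel_measurable (join_alg F H)" "g \<in> borel_measurable (join_alg G H)"
      "integrable M (\<lambda>\<omega>. (f \<omega>)\<^sup>2)" "integrable M (\<lambda>\<omega>. (g \<omega>)\<^sup>2)"
      "AE \<omega> in M. real_cond_exp M H f \<omega> = 0" "AE \<omega> in M. real_cond_exp M H g \<omega> = 0"
    let ?c = "\<bar>\<integral>\<omega>. f \<omega> * g \<omega> \<partial>M\<bar>" and ?d = "sd M f * sd M g"
    have le: "?c \<le> e * ?d" if "e \<in> ?S" for e
    proof -
      from that have "corr_bound M F G H e" by blast
      from this[unfolded corr_bound_def, rule_format, OF fg] show ?thesis
        by (simp only: mult.assoc)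
    qed
    have "0 \<le> ?d" unfolding sd_def by (intro mult_nonneg_nonneg real_sqrt_ge_zero variance_positive)
    then consider "?d = 0" | "?d > 0" by linarith
    then have "?c \<le> subj_corr M F G H * ?d"
    proof cases
      case 1
      then show ?thesis using le[OF one] by (simp only: mult_zero_right)
    next
      case 2
      then have "?c / ?d \<le> Inf ?S"
      proof (intro cInf_greatest)
        show "?S \<noteq> {}" using one by blast
        show "?c / ?d \<le> e" if "e \<in> ?S" for e
          using le[OF that] by (simp only: pos_divide_le_eq[OF 2])
      qed
      then show ?thesis unfolding subj_corr_def by (simp only: pos_divide_le_eq[OF 2])
    qed
    then show "?c \<le> subj_corr M F G H * sd M f * sd M g" by (simp only: mult.assoc)
  qed
qed

end

theory Submission imports Defs "HOL-Library.Function_Algebras" begin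

text \<open>Let \<open>P\<^sub>K\<close> be the conditional expectation given \<open>(X\<^sub>k)\<^sub>k\<^sub>\<in>\<^sub>K\<close>. For \<open>\<E>\<^sub>i(f) = \<parallel>f - P\<^sub>I\<^sub>-\<^sub>i f\<parallel>\<close>
  the correlation bound yields an \<open>L\<^sup>2\<close> version of Dobrushin's comparison:
  \<open>\<E>\<^sub>i(P\<^sub>I\<^sub>-\<^sub>j f) \<le> \<E>\<^sub>i(f) + \<epsilon>(j - i) \<E>\<^sub>j(f)\<close>. Split \<open>\<int>\<^sup>n\<close> into the cosets of a sparse sublattice.
  Within a finite part \<open>A\<close> of a coset the sums of \<open>\<epsilon>\<close> are small, so single-site updates contract
  the energies, and since they are symmetric operators the contraction rate is a lower bound for
  the gap of \<open>A\<close>. For parts \<open>A\<close>, \<open>C\<close> of two cosets, alternate updates of whole blocks contract the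
  energies as well; hence \<open>X\<^sub>A\<close> and \<open>X\<^sub>C\<close> have a correlation bounded away from \<open>1\<close>, whatever else is
  known. As there are finitely many cosets, their gaps combine into one that is uniform over
  finite regions, and the decay of correlations lets the region grow to \<open>\<int>\<^sup>n\<close>.\<close>

section \<open>Families of projections\<close>

text \<open>The obstacle is that the sum of \<open>\<epsilon>\<close> over
  \<open>z \<noteq> 0\<close> may be far above 1, so a contraction argument on the whole lattice
  fails; only each single value is below 1. Cosets leave at most one large value in any row sum:
  none inside a coset, where the sum is at most \<open>\<eta>\<close>, and at most one between two
  cosets, where it is at most \<open>r = m + \<eta>\<close> with \<open>m < 1\<close> bounding all
  values off the origin. What has to be met is \<open>r / (1 - \<eta>) < 1\<close>: the factor
  \<open>1 / (1 - \<eta>)\<close> is the geometric series of repeated updates inside a block. The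
  contraction takes place in the supremum over sites, whose comparison with the Hilbert norm costs a
  constant that depends on the region. For a symmetric operator only the exponential rate of the
  iterates matters, so this constant disappears. Correlation bounds are stated given an arbitrary
  further set \<open>K\<close>, because blocks are revealed one after another, each given the
  earlier ones.\<close>

locale inner_product_on =
  fixes V :: "'v::real_vector set" and ip :: "'v \<Rightarrow> 'v \<Rightarrow> real"
  assumes subspace_V: "subspace V"
    and ip_commute: "x \<in> V \<Longrightarrow> y \<in> V \<Longrightarrow> ip x y = ip y x"
    and ip_add_left: "x \<in> V \<Longrightarrow> y \<in> V \<Longrightarrow> z \<in> V \<Longrightarrow> ip (x + y) z = ip x z + ip y z"
    and ip_scaleR_left: "x \<in> V \<Longrightarrow> z \<in> V \<Longrightarrow> ip (c *\<^sub>R x) z = c * ip x z"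
    and ip_ge_0: "x \<in> V \<Longrightarrow> 0 \<le> ip x x"
    and ip_eq_0: "x \<in> V \<Longrightarrow> ip x x = 0 \<Longrightarrow> x = 0"
begin

lemma V_zero [simp]: "0 \<in> V" and V_add [simp]: "x \<in> V \<Longrightarrow> y \<in> V \<Longrightarrow> x + y \<in> V"
  and V_scaleR [simp]: "x \<in> V \<Longrightarrow> c *\<^sub>R x \<in> V" and V_diff [simp]: "x \<in> V \<Longrightarrow> y \<in> V \<Longrightarrow> x - y \<in> V"
  and V_sum: "(\<And>a. a \<in> A \<Longrightarrow> f a \<in> V) \<Longrightarrow> sum f A \<in> V"
  using subspace_V by (auto simp: subspace_0 subspace_add subspace_scale subspace_diff subspace_sum)

lemma ip_diff_left: "x \<in> V \<Longrightarrow> y \<in> V \<Longrightarrow> z \<in> V \<Longrightarrow> ip (x - y) z = ip x z - ip y z"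
  using ip_add_left[of "x - y" y z] by simp

lemma ip_add_right: "x \<in> V \<Longrightarrow> y \<in> V \<Longrightarrow> z \<in> V \<Longrightarrow> ip z (x + y) = ip z x + ip z y"
  by (simp add: ip_commute[of z] ip_add_left)

lemma ip_diff_right: "x \<in> V \<Longrightarrow> y \<in> V \<Longrightarrow> z \<in> V \<Longrightarrow> ip z (x - y) = ip z x - ip z y"
  by (simp add: ip_commute[of z] ip_diff_left)

lemma ip_scaleR_right: "x \<in> V \<Longrightarrow> z \<in> V \<Longrightarrow> ip z (c *\<^sub>R x) = c * ip z x"
  by (simp add: ip_commute[of z] ip_scaleR_left)

lemma ip_zero_left [simp]: "z \<in> V \<Longrightarrow> ip 0 z = 0"
  using ip_diff_left[of z z z] by simp

lemma ip_zero_right [simp]: "z \<in> V \<Longrightarrow> ip z 0 = 0"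
  by (simp add: ip_commute[of z])

lemma ip_sum_left: "(\<And>a. a \<in> A \<Longrightarrow> f a \<in> V) \<Longrightarrow> z \<in> V \<Longrightarrow> ip (sum f A) z = (\<Sum>a\<in>A. ip (f a) z)"
  by (induction A rule: infinite_finite_induct) (simp_all add: ip_add_left V_sum)

lemmas ip_simps = ip_add_left ip_add_right ip_diff_left ip_diff_right ip_scaleR_left ip_scaleR_right

definition nrm :: "'v \<Rightarrow> real" where "nrm x = sqrt (ip x x)"

lemma nrm_ge_0 [simp]: "x \<in> V \<Longrightarrow> 0 \<le> nrm x"
  by (simp add: nrm_def ip_ge_0)

lemma nrm_zero [simp]: "nrm 0 = 0"
  by (simp add: nrm_def)

lemma nrm_power2: "x \<in> V \<Longrightarrow> (nrm x)\<^sup>2 = ip x x"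
  by (simp add: nrm_def ip_ge_0)

lemma nrm_scaleR: "x \<in> V \<Longrightarrow> nrm (c *\<^sub>R x) = \<bar>c\<bar> * nrm x"
  by (simp add: nrm_def ip_simps real_sqrt_mult mult.assoc[symmetric] power2_eq_square[symmetric])

lemma nrm_minus_commute: "x \<in> V \<Longrightarrow> y \<in> V \<Longrightarrow> nrm (x - y) = nrm (y - x)"
  by (simp add: nrm_def ip_simps)

lemma Cauchy_Schwarz:
  assumes "x \<in> V" "y \<in> V"
  shows "\<bar>ip x y\<bar> \<le> nrm x * nrm y"
proof (cases "y = 0")
  case False
  then have y: "0 < ip y y"
    using assms ip_ge_0[of y] ip_eq_0[of y] by force
  let ?c = "ip x y / ip y y"
  have "0 \<le> ip (x - ?c *\<^sub>R y) (x - ?c *\<^sub>R y)"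
    using assms by (intro ip_ge_0) auto
  also have "\<dots> = ip x x - (ip x y)\<^sup>2 / ip y y"
    using assms y by (simp add: ip_simps ip_commute[of y x] field_simps power2_eq_square)
  finally have "(ip x y)\<^sup>2 \<le> ip x x * ip y y"
    using y by (simp add: field_simps)
  then have "sqrt ((ip x y)\<^sup>2) \<le> sqrt (ip x x * ip y y)"
    by (rule real_sqrt_le_mono)
  then show ?thesis
    by (simp add: nrm_def real_sqrt_mult)
qed (use assms in simp)

lemma nrm_triangle:
  assumes "x \<in> V" "y \<in> V"
  shows "nrm (x + y) \<le> nrm x + nrm y"
proof (rule power2_le_imp_le)
  show "(nrm (x + y))\<^sup>2 \<le> (nrm x + nrm y)\<^sup>2"
    using assms Cauchy_Schwarz[OF assms]
    by (simp add: nrm_power2 power2_sum ip_simps ip_commute[of y x])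
qed (use assms in auto)

lemma V_minus [simp]: "x \<in> V \<Longrightarrow> - x \<in> V"
  using V_diff[of 0 x] by simp

lemma nrm_triangle_diff:
  assumes "x \<in> V" "y \<in> V"
  shows "nrm (x - y) \<le> nrm x + nrm y"
  using nrm_triangle[of x "- y"] assms nrm_scaleR[of y "-1"] by simp

lemma nrm_le_add_diff:
  assumes "x \<in> V" "y \<in> V"
  shows "nrm x \<le> nrm y + nrm (x - y)"
  using nrm_triangle[of y "x - y"] assms by simp

end

text \<open>Log-convexity of \<open>n \<mapsto> \<parallel>T\<^sup>n x\<parallel>\<close> for symmetric \<open>T\<close>: a spectral radius bound,
  with an arbitrary constant, controls a single application of \<open>T\<close>.\<close>

lemma log_convex_growth:
  fixes a :: "nat \<Rightarrow> real"
  assumes pos: "\<And>n. 0 \<le> a n" and cvx: "\<And>n. (a (Suc n))\<^sup>2 \<le> a n * a (Suc (Suc n))"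
    and bd: "\<And>n. a n \<le> c * q ^ n" and q: "0 \<le> q"
  shows "a 1 \<le> q * a 0"
proof (rule ccontr)
  assume "\<not> a 1 \<le> q * a 0"
  then have gt: "q * a 0 < a 1" by simp
  have a1: "0 < a 1"
    using gt mult_nonneg_nonneg[OF q pos[of 0]] by linarith
  have a0: "0 < a 0"
  proof (rule ccontr)
    assume "\<not> 0 < a 0"
    then have "a 0 = 0" using pos[of 0] by simp
    then show False using cvx[of 0] a1 by simp
  qed
  \<comment> \<open>By log-convexity the ratios of successive terms never decrease, so the sequence
    grows at least like \<open>t ^ n\<close>; with \<open>t > q\<close> this outruns
    \<open>c * q ^ n\<close> for any \<open>c\<close>.\<close>
  define t where "t = a 1 / a 0"
  have t: "q < t"
    using gt a0 by (simp add: t_def field_simps)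
  have step: "0 < a n \<and> t * a n \<le> a (Suc n)" for n
  proof (induction n)
    case 0
    then show ?case using a0 by (simp add: t_def)
  next
    case (Suc n)
    then have p: "0 < a (Suc n)"
      using q t mult_pos_pos[of t "a n"] by linarith
    have "a n * (t * a (Suc n)) = (t * a n) * a (Suc n)" by (simp add: ac_simps)
    also have "\<dots> \<le> (a (Suc n))\<^sup>2"
      unfolding power2_eq_square using Suc p by (intro mult_right_mono) auto
    also have "\<dots> \<le> a n * a (Suc (Suc n))" by (rule cvx)
    finally show ?case using Suc p by simp
  qed
  have lower: "a 0 * t ^ n \<le> a n" for n
  proof (induction n)
    case (Suc n)
    have "a 0 * t ^ Suc n = t * (a 0 * t ^ n)" by simp
    also have "\<dots> \<le> t * a n" using Suc q t by (intro mult_left_mono) simp_all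
    also have "\<dots> \<le> a (Suc n)" using step by simp
    finally show ?case .
  qed simp
  have "a 0 \<le> c * (q / t) ^ n" for n
  proof -
    have "a 0 * t ^ n \<le> c * q ^ n" using lower[of n] bd[of n] by linarith
    then show ?thesis using q t by (simp add: power_divide pos_le_divide_eq)
  qed
  moreover have "(\<lambda>n. c * (q / t) ^ n) \<longlonglongrightarrow> c * 0"
    using q t by (intro tendsto_mult tendsto_const LIMSEQ_power_zero) auto
  ultimately have "a 0 \<le> c * 0"
    by (intro LIMSEQ_le_const[of _ "c * 0" "a 0"]) auto
  then show False using a0 by simp
qed

text \<open>\<open>P_sub\<close> and \<open>P_sup\<close> are the two halves of the tower property.
  Projections for sets that are not nested need not commute; correlation bounds measure how far they
  fail to.\<close>

locale projection_family = inner_product_on V ip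
  for V :: "'v::real_vector set" and ip +
  fixes P :: "'i set \<Rightarrow> 'v \<Rightarrow> 'v"
  assumes P_in [simp]: "x \<in> V \<Longrightarrow> P K x \<in> V"
    and P_add: "x \<in> V \<Longrightarrow> y \<in> V \<Longrightarrow> P K (x + y) = P K x + P K y"
    and P_scaleR: "x \<in> V \<Longrightarrow> P K (c *\<^sub>R x) = c *\<^sub>R P K x"
    and P_adj: "x \<in> V \<Longrightarrow> y \<in> V \<Longrightarrow> ip (P K x) y = ip x (P K y)"
    and P_sub: "x \<in> V \<Longrightarrow> K \<subseteq> L \<Longrightarrow> P K (P L x) = P K x"
    and P_sup: "x \<in> V \<Longrightarrow> K \<subseteq> L \<Longrightarrow> P L (P K x) = P K x"
begin

lemma P_diff: "x \<in> V \<Longrightarrow> y \<in> V \<Longrightarrow> P K (x - y) = P K x - P K y"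
  using P_add[of "x - y" y K] by simp

lemma P_zero [simp]: "P K 0 = 0"
  using P_diff[of 0 0 K] by simp

lemma P_sum:
  assumes "\<And>a. a \<in> A \<Longrightarrow> f a \<in> V"
  shows "P K (sum f A) = (\<Sum>a\<in>A. P K (f a))"
proof (cases "finite A")
  case True
  then show ?thesis using assms
  proof (induction A)
    case (insert a A)
    then have "P K (f a + sum f A) = P K (f a) + P K (sum f A)" by (intro P_add V_sum) blast+
    also have "P K (sum f A) = (\<Sum>a\<in>A. P K (f a))" by (rule insert.IH) (rule insert.prems, blast)
    finally show ?case using insert.hyps by simp
  qed simp
qed simp

lemma P_idem [simp]: "x \<in> V \<Longrightarrow> P K (P K x) = P K x"
  by (simp add: P_sub)

lemma ip_P_self: "x \<in> V \<Longrightarrow> ip x (P K x) = (nrm (P K x))\<^sup>2"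
  using P_adj[of x "P K x" K] by (simp add: nrm_power2)

lemma nrm_diff_P: "x \<in> V \<Longrightarrow> (nrm (x - P K x))\<^sup>2 = (nrm x)\<^sup>2 - (nrm (P K x))\<^sup>2"
  using ip_P_self[of x K] by (simp add: nrm_power2 ip_simps ip_commute[of "P K x" x])

lemma nrm_P_le: "x \<in> V \<Longrightarrow> nrm (P K x) \<le> nrm x"
  by (rule power2_le_imp_le) (use nrm_diff_P[of x K] zero_le_power2[of "nrm (x - P K x)"] in simp_all)

lemma nrm_compl_P_le: "x \<in> V \<Longrightarrow> nrm (x - P K x) \<le> nrm x"
  by (rule power2_le_imp_le) (use nrm_diff_P[of x K] in simp_all)

text \<open>\<open>decor C B K \<delta>\<close> says that \<open>1 - \<delta>\<close> bounds the squared correlation of the blocks \<open>C\<close> and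
  \<open>B\<close> given \<open>K\<close>. In this form bounds multiply when blocks are revealed one after another.\<close>

definition decor :: "'i set \<Rightarrow> 'i set \<Rightarrow> 'i set \<Rightarrow> real \<Rightarrow> bool" where
  "decor C B K \<delta> \<longleftrightarrow> (\<forall>x\<in>V. \<delta> * (nrm (P (K \<union> C) x - P K x))\<^sup>2
      \<le> (nrm (P (K \<union> C) x - P (K \<union> B) (P (K \<union> C) x)))\<^sup>2)"

lemma decor_mono: "decor C B K \<delta> \<Longrightarrow> \<delta>' \<le> \<delta> \<Longrightarrow> decor C B K \<delta>'"
  unfolding decor_def by (meson mult_right_mono order_trans zero_le_power2)

text \<open>Pythagoras for \<open>P (K \<union> B)\<close> trades the lower bound on the residual
  for an upper bound on the squared cosine. \<open>decorI\<close> is the converse: the vectors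
  \<open>P (K \<union> C) x - P K x\<close> are exactly those meeting the two side
  conditions.\<close>

lemma decor_nrm:
  assumes "decor C B K \<delta>" "x \<in> V" "P (K \<union> C) x = x" "P K x = 0"
  shows "(nrm (P (K \<union> B) x))\<^sup>2 \<le> (1 - \<delta>) * (nrm x)\<^sup>2"
proof -
  have "\<delta> * (nrm x)\<^sup>2 \<le> (nrm (x - P (K \<union> B) x))\<^sup>2"
    using assms unfolding decor_def by force
  then show ?thesis using assms nrm_diff_P[of x "K \<union> B"] by (simp add: algebra_simps)
qed

lemma decorI:
  assumes "\<And>x. x \<in> V \<Longrightarrow> P (K \<union> C) x = x \<Longrightarrow> P K x = 0 \<Longrightarrow> (nrm (P (K \<union> B) x))\<^sup>2 \<le> (1 - \<delta>) * (nrm x)\<^sup>2"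
  shows "decor C B K \<delta>"
  unfolding decor_def
proof
  fix x assume x: "x \<in> V"
  let ?y = "P (K \<union> C) x - P K x"
  have "(nrm (P (K \<union> B) ?y))\<^sup>2 \<le> (1 - \<delta>) * (nrm ?y)\<^sup>2"
    using x by (intro assms) (auto simp: P_diff P_sub P_sup)
  moreover have "P (K \<union> C) x - P (K \<union> B) (P (K \<union> C) x) = ?y - P (K \<union> B) ?y"
    using x by (simp add: P_diff P_sup)
  ultimately show "\<delta> * (nrm ?y)\<^sup>2 \<le> (nrm (P (K \<union> C) x - P (K \<union> B) (P (K \<union> C) x)))\<^sup>2"
    using x nrm_diff_P[of ?y "K \<union> B"] by (simp add: algebra_simps)
qed

lemma decor_empty: "\<delta> \<le> 1 \<Longrightarrow> decor C {} K \<delta>"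
  by (rule decorI) simp

text \<open>An operator and its adjoint have the same norm. Concretely,
  \<open>(nrm ?y)\<^sup>2\<close> is the inner product of \<open>x\<close> with
  \<open>P (K \<union> B) ?y\<close>, and Cauchy-Schwarz does the rest.\<close>

lemma decor_sym:
  assumes "decor C B K \<delta>" "\<delta> \<le> 1"
  shows "decor B C K \<delta>"
proof (rule decorI)
  fix x assume x: "x \<in> V" "P (K \<union> B) x = x" "P K x = 0"
  let ?y = "P (K \<union> C) x"
  have le: "(nrm (P (K \<union> B) ?y))\<^sup>2 \<le> (1 - \<delta>) * (nrm ?y)\<^sup>2"
    using x by (intro decor_nrm[OF assms(1)]) (simp_all add: P_sub)
  have "(nrm ?y)\<^sup>2 = ip x (P (K \<union> B) ?y)"
    using x P_adj[of x ?y "K \<union> B"] by (simp add: ip_P_self)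
  also have "\<dots> \<le> nrm x * nrm (P (K \<union> B) ?y)"
    using x Cauchy_Schwarz[of x "P (K \<union> B) ?y"] by simp
  finally have *: "(nrm ?y)\<^sup>2 \<le> nrm x * nrm (P (K \<union> B) ?y)" .
  show "(nrm ?y)\<^sup>2 \<le> (1 - \<delta>) * (nrm x)\<^sup>2"
  proof (cases "nrm ?y = 0")
    case True
    then show ?thesis using \<open>\<delta> \<le> 1\<close> by simp
  next
    case False
    then have y: "0 < (nrm ?y)\<^sup>2" by simp
    have "((nrm ?y)\<^sup>2)\<^sup>2 \<le> (nrm x)\<^sup>2 * (nrm (P (K \<union> B) ?y))\<^sup>2"
      using power_mono[OF *, of 2] by (simp add: power_mult_distrib)
    also have "\<dots> \<le> (nrm x)\<^sup>2 * ((1 - \<delta>) * (nrm ?y)\<^sup>2)"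
      using le by (intro mult_left_mono) auto
    finally have "(nrm ?y)\<^sup>2 * (nrm ?y)\<^sup>2 \<le> ((1 - \<delta>) * (nrm x)\<^sup>2) * (nrm ?y)\<^sup>2"
      by (simp add: power2_eq_square algebra_simps)
    then show ?thesis using y by (rule mult_right_le_imp_le)
  qed
qed

lemma decor_union:
  assumes 1: "decor C A K \<delta>1" and 2: "decor C B (K \<union> A) \<delta>2" and "0 \<le> \<delta>2"
  shows "decor C (A \<union> B) K (\<delta>1 * \<delta>2)"
  unfolding decor_def
proof
  fix x assume x: "x \<in> V"
  let ?y = "P (K \<union> C) x"
  have "\<delta>1 * (nrm (?y - P K x))\<^sup>2 \<le> (nrm (?y - P (K \<union> A) ?y))\<^sup>2"
    using 1 x unfolding decor_def by blast
  then have "\<delta>2 * (\<delta>1 * (nrm (?y - P K x))\<^sup>2) \<le> \<delta>2 * (nrm (?y - P (K \<union> A) ?y))\<^sup>2"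
    using \<open>0 \<le> \<delta>2\<close> by (rule mult_left_mono)
  also have "\<dots> \<le> (nrm (?y - P (K \<union> A \<union> B) ?y))\<^sup>2"
  proof -
    \<comment> \<open>The second hypothesis, given \<open>K \<union> A\<close>, applies to the very
      same vector, because the larger projection leaves \<open>?y\<close> unchanged.\<close>
    have "P (K \<union> A \<union> C) ?y = ?y" using x by (intro P_sup) auto
    then show ?thesis using 2[unfolded decor_def, rule_format, of ?y] x by simp
  qed
  finally show "\<delta>1 * \<delta>2 * (nrm (?y - P K x))\<^sup>2 \<le> (nrm (?y - P (K \<union> (A \<union> B)) ?y))\<^sup>2"
    by (simp add: sup_assoc ac_simps)
qed

text \<open>If \<open>?y\<close> is nearly fixed by both projections, then \<open>?p ?y\<close> is
  nearly fixed by \<open>?q\<close>. Decorrelation forces a residual of at least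
  \<open>sqrt \<delta> * nrm (?p ?y)\<close>, so \<open>?p ?y\<close>, and with it
  \<open>?y\<close>, is small. This glues gaps of two blocks into one.\<close>

lemma two_block:
  assumes d: "decor A B K \<delta>" "0 < \<delta>" "\<delta> \<le> 1" and x: "x \<in> V" and W: "W = K \<union> A \<union> B"
  shows "(nrm (P W x - P K x))\<^sup>2
    \<le> 10 / \<delta> * ((nrm (P W x - P (K \<union> A) x))\<^sup>2 + (nrm (P W x - P (K \<union> B) x))\<^sup>2)"
proof -
  let ?y = "P W x - P K x" and ?p = "P (K \<union> A)" and ?q = "P (K \<union> B)"
  have sub: "K \<subseteq> W" "K \<union> A \<subseteq> W" "K \<union> B \<subseteq> W" using W by auto
  have y: "?y \<in> V" "P K ?y = 0" using x sub by (auto simp: P_diff P_sub)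
  have 1: "P W x - ?p x = ?y - ?p ?y" and 2: "P W x - ?q x = ?y - ?q ?y"
    using x sub by (simp_all add: P_diff P_sub P_sup)
  define a b where "a = nrm (?y - ?p ?y)" and "b = nrm (?y - ?q ?y)"
  have ab: "0 \<le> a" "0 \<le> b" using y by (simp_all add: a_def b_def)
  have dec: "\<delta> * (nrm (?p ?y))\<^sup>2 \<le> (nrm (?p ?y - ?q (?p ?y)))\<^sup>2"
    using d(1)[unfolded decor_def, rule_format, OF y(1)] y by simp
  have "nrm (?p ?y - ?q (?p ?y)) = nrm (((?y - ?q ?y) - (?y - ?p ?y)) + ?q (?y - ?p ?y))"
    using y by (simp add: P_diff)
  also have "\<dots> \<le> nrm ((?y - ?q ?y) - (?y - ?p ?y)) + nrm (?q (?y - ?p ?y))"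
    using y by (intro nrm_triangle) simp_all
  also have "\<dots> \<le> (b + a) + a"
    unfolding a_def b_def using y by (intro add_mono nrm_triangle_diff nrm_P_le) simp_all
  finally have le: "nrm (?p ?y - ?q (?p ?y)) \<le> 2 * a + b" by simp
  have "sqrt \<delta> * nrm (?p ?y) \<le> 2 * a + b"
  proof -
    have "sqrt (\<delta> * (nrm (?p ?y))\<^sup>2) \<le> sqrt ((nrm (?p ?y - ?q (?p ?y)))\<^sup>2)"
      using dec by (rule real_sqrt_le_mono)
    then show ?thesis using le y by (simp add: real_sqrt_mult)
  qed
  moreover have "sqrt \<delta> * a \<le> a"
    using d ab by (intro mult_left_le_one_le) auto
  moreover have "nrm ?y \<le> nrm (?p ?y) + a"
    unfolding a_def using y by (intro nrm_le_add_diff) simp_all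
  then have "sqrt \<delta> * nrm ?y \<le> sqrt \<delta> * (nrm (?p ?y) + a)"
    using d by (intro mult_left_mono) auto
  ultimately have "sqrt \<delta> * nrm ?y \<le> 3 * a + b" by (simp add: distrib_left)
  then have "(sqrt \<delta> * nrm ?y)\<^sup>2 \<le> (3 * a + b)\<^sup>2"
    using d y by (intro power_mono) simp_all
  \<comment> \<open>Cauchy-Schwarz with \<open>10 = 3 * 3 + 1 * 1\<close>; the two sides differ by
    the square of \<open>a - 3 * b\<close>.\<close>
  also have "\<dots> \<le> 10 * (a\<^sup>2 + b\<^sup>2)"
    using zero_le_power2[of "a - 3 * b"] by (simp add: power2_eq_square algebra_simps)
  finally have "\<delta> * (nrm ?y)\<^sup>2 \<le> 10 * (a\<^sup>2 + b\<^sup>2)"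
    using d by (simp add: power_mult_distrib)
  then show ?thesis unfolding 1 2 a_def[symmetric] b_def[symmetric]
    using d by (simp add: field_simps)
qed

text \<open>As \<open>?q b = b\<close>, the left side is the commutator of the projections at
  \<open>b\<close>. Planar picture for a unit vector \<open>b\<close> at angle \<open>a\<close> to
  the range of \<open>?p\<close>: \<open>?p b\<close> has length \<open>cos a\<close> and distance
  \<open>cos a * sin a\<close> to the line of \<open>b\<close>, while \<open>sin a\<close> is the
  residual on the right.\<close>

lemma nrm_commutator_le:
  assumes d: "decor C B K (1 - e\<^sup>2)" "0 \<le> e" and b: "b \<in> V" "P (K \<union> C) b = b" "P K b = 0"
  shows "nrm (P (K \<union> B) b - P (K \<union> C) (P (K \<union> B) b)) \<le> e * nrm (b - P (K \<union> B) b)"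
proof (rule power2_le_imp_le)
  let ?p = "P (K \<union> B)" and ?q = "P (K \<union> C)"
  define s t u where "s = (nrm b)\<^sup>2" and "t = (nrm (?p b))\<^sup>2" and "u = (nrm (?q (?p b)))\<^sup>2"
  have ts: "t \<le> e\<^sup>2 * s" using decor_nrm[OF d(1) b] by (simp add: s_def t_def)
  have ts': "t \<le> s" unfolding s_def t_def using b nrm_P_le by (intro power_mono) simp_all
  have "t = ip b (?q (?p b))"
    unfolding t_def using b P_adj[of b "?p b" "K \<union> C"] by (simp add: ip_P_self)
  also have "\<dots> \<le> nrm b * nrm (?q (?p b))"
    using b Cauchy_Schwarz[of b "?q (?p b)"] by simp
  finally have "t\<^sup>2 \<le> (nrm b * nrm (?q (?p b)))\<^sup>2"
    by (rule power_mono) (simp add: t_def)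
  then have tu: "t * t \<le> s * u"
    by (simp add: s_def u_def power2_eq_square ac_simps)
  have "0 \<le> s" "0 \<le> t" "0 \<le> u" by (simp_all add: s_def t_def u_def)
  have "t - u \<le> e\<^sup>2 * (s - t)"
  proof (cases "s = 0")
    case True
    then show ?thesis using ts' \<open>0 \<le> t\<close> \<open>0 \<le> u\<close> by simp
  next
    case False
    then have "0 < s" using \<open>0 \<le> s\<close> by simp
    have "s * (t - u) \<le> t * (s - t)" using tu by (simp add: algebra_simps)
    also have "\<dots> \<le> (e\<^sup>2 * s) * (s - t)" using ts ts' by (intro mult_right_mono) auto
    finally have "s * (t - u) \<le> s * (e\<^sup>2 * (s - t))" by (simp add: ac_simps)
    then show ?thesis using \<open>0 < s\<close> by (rule mult_left_le_imp_le)
  qed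
  then show "(nrm (?p b - ?q (?p b)))\<^sup>2 \<le> (e * nrm (b - ?p b))\<^sup>2"
    using b by (simp add: power_mult_distrib nrm_diff_P s_def t_def u_def)
  show "0 \<le> e * nrm (b - ?p b)" using d b by simp
qed

text \<open>Dobrushin's comparison: in the space where \<open>P\<^sub>K\<close> vanishes the ranges of the two projections
  meet at an angle of cosine at most \<open>e\<close>, hence so do their complements, up to common vectors,
  and these are removed by the update.\<close>

lemma nrm_compl_update_le:
  assumes d: "decor C B K (1 - e\<^sup>2)" "0 \<le> e" and x: "x \<in> V"
  shows "nrm (P (K \<union> C) x - P (K \<union> B) (P (K \<union> C) x))
    \<le> nrm (x - P (K \<union> B) x) + e * nrm (x - P (K \<union> C) x)"
proof -
  let ?p = "P (K \<union> B)" and ?q = "P (K \<union> C)"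
  define b y where "b = ?q x - P K x" and "y = x - ?q x"
  have b: "b \<in> V" "?q b = b" "P K b = 0" and y: "y \<in> V" "?q y = 0"
    using x by (simp_all add: b_def y_def P_diff P_sub P_sup)
  have *: "?q x - ?p (?q x) = b - ?p b"
    using x by (simp add: b_def P_diff P_sup)
  have "x - ?p x = (b - ?p b) + (y - ?p y)"
    using x unfolding *[symmetric] by (simp add: y_def P_diff)
  then have 1: "ip (b - ?p b) (x - ?p x) = (nrm (b - ?p b))\<^sup>2 + ip (b - ?p b) (y - ?p y)"
    using b y by (simp add: ip_add_right nrm_power2)
  have 2: "ip (b - ?p b) (y - ?p y) = ip (b - ?p b) y"
    using b y P_adj[of "b" y "K \<union> B"] P_adj[of "?p b" y "K \<union> B"]
    by (simp add: ip_simps P_diff)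
  \<comment> \<open>\<open>y\<close> is orthogonal to the range of \<open>?q\<close>, which contains
    \<open>b\<close> and \<open>?q (?p b)\<close>; only the commutator term meets
    \<open>y\<close>.\<close>
  have 3: "ip (b - ?p b) y = - ip (?p b - ?q (?p b)) y"
    using b y P_adj[of "?p b" y "K \<union> C"] P_adj[of "b" y "K \<union> C"] by (simp add: ip_simps)
  have "ip (?p b - ?q (?p b)) y \<le> nrm (?p b - ?q (?p b)) * nrm y"
    using b y Cauchy_Schwarz[of "?p b - ?q (?p b)" y] by simp
  also have "\<dots> \<le> e * nrm (b - ?p b) * nrm y"
    using nrm_commutator_le[OF d b] y by (intro mult_right_mono) simp_all
  finally have "(nrm (b - ?p b))\<^sup>2 - e * nrm (b - ?p b) * nrm y \<le> ip (b - ?p b) (x - ?p x)"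
    using 1 2 3 by linarith
  also have "\<dots> \<le> nrm (b - ?p b) * nrm (x - ?p x)"
    using b x Cauchy_Schwarz[of "b - ?p b" "x - ?p x"] by simp
  finally have "nrm (b - ?p b) * nrm (b - ?p b) \<le> nrm (b - ?p b) * (nrm (x - ?p x) + e * nrm y)"
    by (simp add: power2_eq_square algebra_simps)
  moreover have "0 \<le> nrm (x - ?p x) + e * nrm y" using x y d by simp
  moreover have "0 \<le> nrm (b - ?p b)" using b by simp
  ultimately have "nrm (b - ?p b) \<le> nrm (x - ?p x) + e * nrm y"
    by (cases "nrm (b - ?p b) = 0") (simp_all add: mult_le_cancel_left_pos)
  then show ?thesis by (simp add: * y_def)
qed

section \<open>Single-site energies and gaps of finite regions\<close>

definition energy :: "'i set \<Rightarrow> 'i \<Rightarrow> 'v \<Rightarrow> real" where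
  "energy W i x = nrm (P W x - P (W - {i}) x)"

lemma energy_ge_0 [simp]: "x \<in> V \<Longrightarrow> 0 \<le> energy W i x"
  by (simp add: energy_def)

lemma energy_zero:
  assumes "x \<in> V" "i \<in> S"
  shows "energy W i (P (W - S) x) = 0"
proof -
  have "P W (P (W - S) x) = P (W - S) x" "P (W - {i}) (P (W - S) x) = P (W - S) x"
    using assms by (auto intro!: P_sup)
  then show ?thesis by (simp add: energy_def)
qed

lemma energy_add_le: "x \<in> V \<Longrightarrow> y \<in> V \<Longrightarrow> energy W i (x + y) \<le> energy W i x + energy W i y"
  using nrm_triangle[of "P W x - P (W - {i}) x" "P W y - P (W - {i}) y"]
  by (simp add: energy_def P_add algebra_simps)

lemma energy_scaleR: "x \<in> V \<Longrightarrow> energy W i (c *\<^sub>R x) = \<bar>c\<bar> * energy W i x"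
  by (simp add: energy_def P_scaleR nrm_scaleR scaleR_diff_right[symmetric])

lemma energy_le_nrm:
  assumes "x \<in> V"
  shows "energy W i x \<le> nrm x"
proof -
  have "energy W i x = nrm (P W x - P (W - {i}) (P W x))"
    using assms by (simp add: energy_def P_sub subset_eq)
  also have "\<dots> \<le> nrm (P W x)" using assms by (intro nrm_compl_P_le) simp
  also have "\<dots> \<le> nrm x" using assms by (rule nrm_P_le)
  finally show ?thesis .
qed

lemma energy_sum_le:
  assumes "finite A" "\<And>a. a \<in> A \<Longrightarrow> f a \<in> V"
  shows "energy W i (sum f A) \<le> (\<Sum>a\<in>A. energy W i (f a))"
  using assms
proof (induction A)
  case empty
  then show ?case by (simp add: energy_def)
next
  case (insert a A)
  have "energy W i (f a + sum f A) \<le> energy W i (f a) + energy W i (sum f A)"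
    using insert.prems by (intro energy_add_le V_sum) blast+
  also have "energy W i (sum f A) \<le> (\<Sum>a\<in>A. energy W i (f a))"
    by (rule insert.IH) (rule insert.prems, blast)
  finally show ?case using insert.hyps by simp
qed

text \<open>For \<open>C > 0\<close>, \<open>1 / C\<close> bounds from below the spectral gap of the
  dynamics in \<open>S\<close> with the sites of \<open>W - S\<close> frozen and those outside
  \<open>W\<close> averaged out. Energies are squared only here, since the comparison of updates is
  linear in norms.\<close>

definition gap_bound :: "'i set \<Rightarrow> 'i set \<Rightarrow> real \<Rightarrow> bool" where
  "gap_bound W S C \<longleftrightarrow> (\<forall>x\<in>V. (nrm (P W x - P (W - S) x))\<^sup>2 \<le> C * (\<Sum>i\<in>S. (energy W i x)\<^sup>2))"

lemma gap_bound_mono: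
  assumes "gap_bound W S C" "C \<le> C'"
  shows "gap_bound W S C'"
  unfolding gap_bound_def
proof
  fix x assume "x \<in> V"
  then have "(nrm (P W x - P (W - S) x))\<^sup>2 \<le> C * (\<Sum>i\<in>S. (energy W i x)\<^sup>2)"
    using assms(1) by (simp add: gap_bound_def)
  also have "\<dots> \<le> C' * (\<Sum>i\<in>S. (energy W i x)\<^sup>2)"
    using assms(2) by (intro mult_right_mono sum_nonneg) simp_all
  finally show "(nrm (P W x - P (W - S) x))\<^sup>2 \<le> C' * (\<Sum>i\<in>S. (energy W i x)\<^sup>2)" .
qed

end

text \<open>\<open>decor_single\<close> has the same \<open>\<epsilon>\<close> for every
  \<open>K\<close>: this is what the supremum over conditioning sets in \<open>corr_star\<close>
  provides.\<close>

locale decorrelated_family = projection_family V ip P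
  for V :: "'v::real_vector set" and ip and P :: "'i set \<Rightarrow> 'v \<Rightarrow> 'v" +
  fixes \<epsilon> :: "'i \<Rightarrow> 'i \<Rightarrow> real"
  assumes eps_ge_0: "0 \<le> \<epsilon> i j"
    and eps_less_1: "i \<noteq> j \<Longrightarrow> \<epsilon> i j < 1"
    and decor_single: "i \<noteq> j \<Longrightarrow> decor {i} {j} K (1 - (\<epsilon> i j)\<^sup>2)"
begin

lemma eps_factor: "i \<noteq> j \<Longrightarrow> 0 < 1 - (\<epsilon> i j)\<^sup>2" "1 - (\<epsilon> i j)\<^sup>2 \<le> 1"
  using eps_ge_0[of i j] eps_less_1[of i j] by (auto simp: power_less_one_iff abs_square_less_1)

lemma decor_single_finite:
  assumes "finite S" "i \<notin> S"
  shows "decor {i} S K (\<Prod>j\<in>S. 1 - (\<epsilon> i j)\<^sup>2)"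
  using assms
proof (induction S arbitrary: K)
  case empty
  then show ?case by (simp add: decor_empty)
next
  case (insert j S)
  have "decor {i} ({j} \<union> S) K ((1 - (\<epsilon> i j)\<^sup>2) * (\<Prod>j\<in>S. 1 - (\<epsilon> i j)\<^sup>2))"
    using insert by (intro decor_union decor_single prod_nonneg less_imp_le[OF eps_factor(1)]) auto
  then show ?case using insert by simp
qed

text \<open>The constant comes from adding sites one at a time and degenerates as \<open>S\<close>
  grows. It only serves to turn decay of the energies of iterates into decay of their norms, where
  any constant will do.\<close>

lemma gap_bound_crude:
  assumes "finite S" "S \<subseteq> W"
  shows "\<exists>C\<ge>0. gap_bound W S C"
  using assms
proof (induction S)
  case empty
  then show ?case by (intro exI[of _ 0]) (simp add: gap_bound_def)
next
  case (insert i S)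
  then obtain C where C: "C \<ge> 0" "gap_bound W S C" by auto
  define \<delta> where "\<delta> = (\<Prod>j\<in>S. 1 - (\<epsilon> i j)\<^sup>2)"
  have "0 < 1 - (\<epsilon> i j)\<^sup>2 \<and> 1 - (\<epsilon> i j)\<^sup>2 \<le> 1" if "j \<in> S" for j
    using eps_factor[of i j] insert.hyps that by blast
  then have d: "0 < \<delta>" "\<delta> \<le> 1"
    unfolding \<delta>_def by (intro prod_pos prod_le_1 conjI; force)+
  let ?K = "W - insert i S"
  have eq: "W = ?K \<union> {i} \<union> S" "?K \<union> {i} = W - S" "?K \<union> S = W - {i}" using insert by auto
  have "gap_bound W (insert i S) (10 / \<delta> * max C 1)"
    unfolding gap_bound_def
  proof
    fix x assume x: "x \<in> V"
    have "(nrm (P W x - P ?K x))\<^sup>2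
        \<le> 10 / \<delta> * ((nrm (P W x - P (W - S) x))\<^sup>2 + (energy W i x)\<^sup>2)"
      using two_block[OF decor_single_finite[of S i ?K, folded \<delta>_def] d x eq(1)] insert
      unfolding eq(2,3) energy_def by blast
    also have "\<dots> \<le> 10 / \<delta> * (max C 1 * (\<Sum>i\<in>S. (energy W i x)\<^sup>2) + max C 1 * (energy W i x)\<^sup>2)"
    proof (intro mult_left_mono add_mono)
      show "(nrm (P W x - P (W - S) x))\<^sup>2 \<le> max C 1 * (\<Sum>i\<in>S. (energy W i x)\<^sup>2)"
        using gap_bound_mono[OF C(2), of "max C 1"] x by (simp add: gap_bound_def)
      show "(energy W i x)\<^sup>2 \<le> max C 1 * (energy W i x)\<^sup>2"
        using mult_right_mono[of 1 "max C 1" "(energy W i x)\<^sup>2"] by simp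
    qed (use d in auto)
    finally show "(nrm (P W x - P (W - insert i S) x))\<^sup>2
        \<le> 10 / \<delta> * max C 1 * (\<Sum>i\<in>insert i S. (energy W i x)\<^sup>2)"
      using insert by (simp add: distrib_left ac_simps)
  qed
  moreover have "0 \<le> 10 / \<delta> * max C 1" using d by simp
  ultimately show ?case by blast
qed

text \<open>This is \<open>nrm_compl_update_le\<close> given \<open>K = W - {i, j}\<close>: the
  update of \<open>j\<close> is then the projection for \<open>K \<union> {i}\<close>, that of
  \<open>i\<close> the one for \<open>K \<union> {j}\<close>.\<close>

lemma energy_update_le:
  assumes "i \<noteq> j" "i \<in> W" "j \<in> W" and x: "x \<in> V"
  shows "energy W i (P (W - {j}) x) \<le> energy W i x + \<epsilon> i j * energy W j x"
proof -
  let ?K = "W - {i, j}"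
  have eq: "?K \<union> {i} = W - {j}" "?K \<union> {j} = W - {i}" using assms by auto
  have "nrm (P (W - {j}) (P W x) - P (W - {i}) (P (W - {j}) (P W x)))
      \<le> nrm (P W x - P (W - {i}) (P W x)) + \<epsilon> i j * nrm (P W x - P (W - {j}) (P W x))"
    using nrm_compl_update_le[OF decor_single[OF assms(1)] eps_ge_0, of "P W x" ?K] x
    unfolding eq by simp
  then show ?thesis using x by (simp add: energy_def P_sub P_sup)
qed

end

section \<open>Contraction of energies\<close>

context projection_family begin

text \<open>One step of the random-scan dynamics in \<open>A\<close>.\<close>

definition avg :: "'i set \<Rightarrow> 'i set \<Rightarrow> 'v \<Rightarrow> 'v" where
  "avg W A x = (1 / card A) *\<^sub>R (\<Sum>j\<in>A. P (W - {j}) x)"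

lemma avg_in [simp]: "x \<in> V \<Longrightarrow> avg W A x \<in> V"
  by (simp add: avg_def V_sum)

lemma avg_pow_in [simp]: "x \<in> V \<Longrightarrow> (avg W A ^^ n) x \<in> V"
  by (induction n) simp_all

text \<open>Symmetry is what makes the norms of the iterates of \<open>avg\<close>
  log-convex.\<close>

lemma avg_adj:
  assumes "x \<in> V" "y \<in> V"
  shows "ip (avg W A x) y = ip x (avg W A y)"
proof -
  have "ip (avg W A u) v = (1 / card A) * (\<Sum>j\<in>A. ip (P (W - {j}) u) v)" if "u \<in> V" "v \<in> V" for u v
    using that by (simp add: avg_def ip_scaleR_left V_sum ip_sum_left)
  moreover have "ip (P (W - {j}) x) y = ip (P (W - {j}) y) x" for j
    using assms by (simp add: P_adj ip_commute[of x])
  ultimately show ?thesis using assms by (simp add: ip_commute[of x])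
qed

lemma P_avg:
  assumes "finite A" "A \<noteq> {}" "x \<in> V"
  shows "P (W - A) (avg W A x) = P (W - A) x"
proof -
  have "P (W - A) (avg W A x) = (1 / card A) *\<^sub>R (\<Sum>j\<in>A. P (W - A) (P (W - {j}) x))"
    using assms by (simp add: avg_def P_scaleR P_sum V_sum)
  also have "(\<Sum>j\<in>A. P (W - A) (P (W - {j}) x)) = (\<Sum>j\<in>A. P (W - A) x)"
    using assms by (intro sum.cong refl P_sub) auto
  finally show ?thesis using assms by (simp add: sum_constant_scaleR)
qed

lemma P_avg_sup:
  assumes "x \<in> V"
  shows "P W (avg W A x) = avg W A x"
proof -
  have "P W (P (W - {j}) x) = P (W - {j}) x" for j
    using assms by (intro P_sup) auto
  then show ?thesis using assms by (simp add: avg_def P_scaleR P_sum V_sum)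
qed

lemma energy_avg_le:
  assumes "finite A" "x \<in> V"
  shows "energy W i (avg W A x) \<le> (1 / card A) * (\<Sum>j\<in>A. energy W i (P (W - {j}) x))"
proof -
  have "energy W i (avg W A x) = (1 / card A) * energy W i (\<Sum>j\<in>A. P (W - {j}) x)"
    using assms by (simp add: avg_def energy_scaleR V_sum)
  also have "\<dots> \<le> (1 / card A) * (\<Sum>j\<in>A. energy W i (P (W - {j}) x))"
    using assms by (intro mult_left_mono energy_sum_le) simp_all
  finally show ?thesis .
qed

end

context decorrelated_family begin

text \<open>With weight \<open>1 / card A\<close> the site \<open>i\<close> itself is updated and
  its energy vanishes; an update of another site \<open>j\<close> adds at most
  \<open>\<epsilon> i j * c\<close>. So the largest energy in \<open>A\<close> shrinks by the factor
  \<open>1 - (1 - \<eta>) / card A\<close>.\<close>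

lemma energy_avg_inside:
  assumes A: "finite A" "A \<subseteq> W" "i \<in> A" and x: "x \<in> V"
    and c: "\<And>j. j \<in> A \<Longrightarrow> energy W j x \<le> c" and \<eta>: "(\<Sum>j\<in>A - {i}. \<epsilon> i j) \<le> \<eta>"
  shows "energy W i (avg W A x) \<le> (1 - (1 - \<eta>) / card A) * c"
proof -
  have N: "0 < card A" using A card_gt_0_iff by blast
  have c0: "0 \<le> c" using c[OF A(3)] energy_ge_0[OF x, of W i] by linarith
  have "(\<Sum>j\<in>A. energy W i (P (W - {j}) x)) = (\<Sum>j\<in>A - {i}. energy W i (P (W - {j}) x))"
    using A x energy_zero[of x i "{i}" W] by (simp add: sum.remove[of A i])
  also have "\<dots> \<le> (\<Sum>j\<in>A - {i}. c + \<epsilon> i j * c)"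
  proof (rule sum_mono)
    fix j assume j: "j \<in> A - {i}"
    have "energy W i (P (W - {j}) x) \<le> energy W i x + \<epsilon> i j * energy W j x"
      using A j x by (intro energy_update_le) auto
    also have "\<dots> \<le> c + \<epsilon> i j * c"
      using A j eps_ge_0 by (intro add_mono mult_left_mono c) auto
    finally show "energy W i (P (W - {j}) x) \<le> c + \<epsilon> i j * c" .
  qed
  also have "\<dots> = (real (card A) - 1) * c + (\<Sum>j\<in>A - {i}. \<epsilon> i j) * c"
    using A N by (simp add: sum.distrib sum_distrib_right of_nat_diff)
  also have "\<dots> \<le> (real (card A) - 1) * c + \<eta> * c"
    using \<eta> c0 by (intro add_left_mono mult_right_mono)
  finally have "1 / card A * (\<Sum>j\<in>A. energy W i (P (W - {j}) x))
      \<le> 1 / card A * ((real (card A) - 1) * c + \<eta> * c)"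
    by (intro mult_left_mono) simp_all
  also have "\<dots> = (1 - (1 - \<eta>) / card A) * c" using N by (simp add: field_simps)
  finally show ?thesis using energy_avg_le[OF A(1) x, of W i] by linarith
qed

lemma energy_avg_outside:
  assumes A: "finite A" "A \<noteq> {}" "A \<subseteq> W" "i \<in> W - A" and x: "x \<in> V"
    and c: "\<And>j. j \<in> A \<Longrightarrow> energy W j x \<le> c" and r: "(\<Sum>j\<in>A. \<epsilon> i j) \<le> r"
  shows "energy W i (avg W A x) \<le> energy W i x + r * c / card A"
proof -
  have N: "0 < card A" using A card_gt_0_iff by blast
  obtain j0 where "j0 \<in> A" using A by blast
  then have c0: "0 \<le> c" using c[of j0] energy_ge_0[OF x, of W j0] by linarith
  have "(\<Sum>j\<in>A. energy W i (P (W - {j}) x)) \<le> (\<Sum>j\<in>A. energy W i x + \<epsilon> i j * c)"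
  proof (rule sum_mono)
    fix j assume j: "j \<in> A"
    have "energy W i (P (W - {j}) x) \<le> energy W i x + \<epsilon> i j * energy W j x"
      using A j x by (intro energy_update_le) auto
    also have "\<dots> \<le> energy W i x + \<epsilon> i j * c"
      using j eps_ge_0 by (intro add_left_mono mult_left_mono c) auto
    finally show "energy W i (P (W - {j}) x) \<le> energy W i x + \<epsilon> i j * c" .
  qed
  also have "\<dots> = card A * energy W i x + (\<Sum>j\<in>A. \<epsilon> i j) * c"
    by (simp add: sum.distrib sum_distrib_right)
  also have "\<dots> \<le> card A * energy W i x + r * c"
    using r c0 by (intro add_left_mono mult_right_mono)
  finally have "1 / card A * (\<Sum>j\<in>A. energy W i (P (W - {j}) x))
      \<le> 1 / card A * (card A * energy W i x + r * c)"
    by (intro mult_left_mono) simp_all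
  also have "\<dots> = energy W i x + r * c / card A" using N by (simp add: field_simps)
  finally show ?thesis using energy_avg_le[OF A(1) x, of W i] by linarith
qed

lemma energy_avg_pow_inside:
  assumes A: "finite A" "A \<subseteq> W" and x: "x \<in> V"
    and c: "\<And>j. j \<in> A \<Longrightarrow> energy W j x \<le> c"
    and \<eta>: "\<And>i. i \<in> A \<Longrightarrow> (\<Sum>j\<in>A - {i}. \<epsilon> i j) \<le> \<eta>" and "i \<in> A"
  shows "energy W i ((avg W A ^^ n) x) \<le> c * (1 - (1 - \<eta>) / card A) ^ n"
  using \<open>i \<in> A\<close>
proof (induction n arbitrary: i)
  case 0
  then show ?case using c by simp
next
  case (Suc n)
  have "energy W i (avg W A ((avg W A ^^ n) x))
      \<le> (1 - (1 - \<eta>) / card A) * (c * (1 - (1 - \<eta>) / card A) ^ n)"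
    using A x Suc \<eta> by (intro energy_avg_inside) auto
  then show ?case by (simp add: ac_simps)
qed

text \<open>The site \<open>i\<close> is never updated; it only receives influence from energies in
  \<open>A\<close>, which decay geometrically. In the sum of the series the \<open>card A\<close> of
  the rate cancels that of the weights, so the total is at most \<open>r * c / (1 - \<eta>)\<close>
  whatever the size of \<open>A\<close>.\<close>

lemma energy_avg_pow_outside:
  assumes A: "finite A" "A \<noteq> {}" "A \<subseteq> W" and x: "x \<in> V"
    and c: "\<And>j. j \<in> A \<Longrightarrow> energy W j x \<le> c"
    and \<eta>: "\<And>i. i \<in> A \<Longrightarrow> (\<Sum>j\<in>A - {i}. \<epsilon> i j) \<le> \<eta>" "\<eta> < 1"
    and i: "i \<in> W - A" and r: "(\<Sum>j\<in>A. \<epsilon> i j) \<le> r"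
  shows "energy W i ((avg W A ^^ n) x)
    \<le> energy W i x + r * c / (1 - \<eta>) * (1 - (1 - (1 - \<eta>) / card A) ^ n)"
proof (induction n)
  case (Suc n)
  let ?q = "1 - (1 - \<eta>) / card A"
  have N: "0 < card A" using A card_gt_0_iff by blast
  have "energy W i (avg W A ((avg W A ^^ n) x))
      \<le> energy W i ((avg W A ^^ n) x) + r * (c * ?q ^ n) / card A"
    using A x i r energy_avg_pow_inside[OF A(1,3) x c \<eta>(1)]
    by (intro energy_avg_outside) auto
  also have "\<dots> \<le> (energy W i x + r * c / (1 - \<eta>) * (1 - ?q ^ n)) + r * (c * ?q ^ n) / card A"
    using Suc by simp
  \<comment> \<open>\<open>1 - ?q = (1 - \<eta>) / card A\<close> makes the increments
    telescope.\<close>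
  also have "r * (c * ?q ^ n) / card A = r * c / (1 - \<eta>) * (?q ^ n - ?q ^ Suc n)"
    using \<eta> N by (simp add: field_simps)
  finally show ?case by (simp add: algebra_simps)
qed (use x in simp)

lemma avg_pow_props:
  assumes "finite A" "A \<noteq> {}" "x \<in> V" "P W x = x"
  shows "P (W - A) ((avg W A ^^ n) x) = P (W - A) x" "P W ((avg W A ^^ n) x) = (avg W A ^^ n) x"
proof -
  show "P (W - A) ((avg W A ^^ n) x) = P (W - A) x"
    by (induction n) (use assms in \<open>simp_all add: P_avg\<close>)
  show "P W ((avg W A ^^ n) x) = (avg W A ^^ n) x"
    by (cases n) (use assms in \<open>simp_all add: P_avg_sup\<close>)
qed

text \<open>All iterates share the projection \<open>P (W - A) x\<close>, so the crude gap bounds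
  their distance to it by their energies, and these decay at the stated rate.\<close>

lemma avg_pow_converges:
  assumes A: "finite A" "A \<noteq> {}" "A \<subseteq> W" and x: "x \<in> V" "P W x = x"
    and \<eta>: "\<And>i. i \<in> A \<Longrightarrow> (\<Sum>j\<in>A - {i}. \<epsilon> i j) \<le> \<eta>" "\<eta> < 1"
  shows "\<exists>C. \<forall>n. nrm ((avg W A ^^ n) x - P (W - A) x) \<le> C * (1 - (1 - \<eta>) / card A) ^ n"
proof -
  let ?q = "1 - (1 - \<eta>) / card A"
  have N: "0 < card A" using A card_gt_0_iff by blast
  obtain i0 where "i0 \<in> A" using A by blast
  have "0 \<le> (\<Sum>j\<in>A - {i0}. \<epsilon> i0 j)" by (intro sum_nonneg eps_ge_0)
  also have "\<dots> \<le> \<eta>" by (rule \<eta>) fact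
  finally have \<eta>0: "0 \<le> \<eta>" .
  have q0: "0 \<le> ?q" using N \<eta>0 by (simp add: field_simps)
  obtain C where C: "C \<ge> 0" "gap_bound W A C" using gap_bound_crude A by blast
  have "nrm ((avg W A ^^ n) x - P (W - A) x) \<le> sqrt (C * card A) * nrm x * ?q ^ n" for n
  proof -
    let ?y = "(avg W A ^^ n) x"
    have y: "?y \<in> V" using x by simp
    have "(nrm (?y - P (W - A) x))\<^sup>2 = (nrm (P W ?y - P (W - A) ?y))\<^sup>2"
      using avg_pow_props[OF A(1,2) x] by simp
    also have "\<dots> \<le> C * (\<Sum>i\<in>A. (energy W i ?y)\<^sup>2)"
      using C y unfolding gap_bound_def by blast
    also have "\<dots> \<le> C * (\<Sum>i\<in>A. (nrm x * ?q ^ n)\<^sup>2)"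
    proof (intro mult_left_mono sum_mono power_mono C)
      fix i assume "i \<in> A"
      then show "energy W i ?y \<le> nrm x * ?q ^ n"
        using A x \<eta> energy_le_nrm by (intro energy_avg_pow_inside) auto
    qed (use y in simp)
    also have "\<dots> = (sqrt (C * card A) * nrm x * ?q ^ n)\<^sup>2"
      using C by (simp add: power_mult_distrib)
    finally show ?thesis
      by (rule power2_le_imp_le) (use C x q0 in simp)
  qed
  then show ?thesis by blast
qed

text \<open>If \<open>P (W - A) y = 0\<close>, the iterates of \<open>avg\<close> decay at rate
  \<open>?q\<close>, hence by symmetry one step already contracts by \<open>?q\<close>. The squared
  energies sum to \<open>card A * ((nrm y)\<^sup>2 - ip (avg W A y) y)\<close>, and
  \<open>card A * (1 - ?q) = 1 - \<eta>\<close>.\<close>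

lemma gap_bound_dilute:
  assumes A: "finite A" "A \<subseteq> W"
    and \<eta>: "\<And>i. i \<in> A \<Longrightarrow> (\<Sum>j\<in>A - {i}. \<epsilon> i j) \<le> \<eta>" "\<eta> < 1"
  shows "gap_bound W A (1 / (1 - \<eta>))"
proof (cases "A = {}")
  case True
  then show ?thesis by (simp add: gap_bound_def)
next
  case False
  let ?q = "1 - (1 - \<eta>) / card A"
  have N: "0 < card A" using A False card_gt_0_iff by blast
  show ?thesis
    unfolding gap_bound_def
  proof
    fix x assume x: "x \<in> V"
    define y where "y = P W x - P (W - A) x"
    have sub: "W - A \<subseteq> W" by auto
    have y: "y \<in> V" "P W y = y" "P (W - A) y = 0"
      using x sub by (simp_all add: y_def P_diff P_sub P_sup)
    \<comment> \<open>Subtracting \<open>P (W - A) x\<close> changes no energy inside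
      \<open>A\<close>, so the normalised \<open>y\<close> may replace \<open>x\<close>.\<close>
    have en: "energy W i y = energy W i x" if "i \<in> A" for i
    proof -
      have "P (W - {i}) (P (W - A) x) = P (W - A) x" "P (W - {i}) (P W x) = P (W - {i}) x"
        using that x by (auto intro!: P_sup P_sub)
      then show ?thesis using x sub by (simp add: energy_def y_def P_diff P_sup)
    qed
    obtain C where C: "\<And>n. nrm ((avg W A ^^ n) y - P (W - A) y) \<le> C * ?q ^ n"
      using avg_pow_converges[OF A(1) False A(2) y(1,2) \<eta>] by blast
    have q0: "0 \<le> ?q"
    proof -
      obtain i0 where i0: "i0 \<in> A" using False by blast
      have "0 \<le> (\<Sum>j\<in>A - {i0}. \<epsilon> i0 j)" by (intro sum_nonneg eps_ge_0)
      then have "0 \<le> \<eta>" using \<eta>(1)[OF i0] by linarith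
      then show ?thesis using N by (simp add: field_simps)
    qed
    have "nrm ((avg W A ^^ 1) y) \<le> ?q * nrm ((avg W A ^^ 0) y)"
    proof (rule log_convex_growth[of _ C])
      fix n
      show "nrm ((avg W A ^^ n) y) \<le> C * ?q ^ n" using C[of n] y by simp
      let ?z = "(avg W A ^^ n) y"
      have "(nrm (avg W A ?z))\<^sup>2 = ip ?z (avg W A (avg W A ?z))"
        using y by (simp add: nrm_power2 avg_adj)
      also have "\<dots> \<le> nrm ?z * nrm (avg W A (avg W A ?z))"
        using y Cauchy_Schwarz[of ?z "avg W A (avg W A ?z)"] by simp
      finally show "(nrm ((avg W A ^^ Suc n) y))\<^sup>2 \<le> nrm ?z * nrm ((avg W A ^^ Suc (Suc n)) y)"
        by simp
    qed (use y q0 in simp_all)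
    then have "nrm (avg W A y) \<le> ?q * nrm y" by simp
    have "ip (avg W A y) y \<le> nrm (avg W A y) * nrm y"
      using Cauchy_Schwarz[of "avg W A y" y] y by simp
    also have "\<dots> \<le> ?q * (nrm y)\<^sup>2"
      using \<open>nrm (avg W A y) \<le> ?q * nrm y\<close> y by (simp add: power2_eq_square mult.assoc[symmetric] mult_right_mono)
    finally have le: "ip (avg W A y) y \<le> ?q * (nrm y)\<^sup>2" .
    have "(energy W j y)\<^sup>2 = (nrm y)\<^sup>2 - ip (P (W - {j}) y) y" for j
      using y nrm_diff_P[of y "W - {j}"] ip_P_self[of y "W - {j}"]
      by (simp add: energy_def ip_commute)
    then have "(\<Sum>j\<in>A. (energy W j y)\<^sup>2) = card A * (nrm y)\<^sup>2 - (\<Sum>j\<in>A. ip (P (W - {j}) y) y)"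
      by (simp add: sum_subtractf)
    also have "(\<Sum>j\<in>A. ip (P (W - {j}) y) y) = card A * ip (avg W A y) y"
      using y N by (simp add: avg_def ip_scaleR_left V_sum ip_sum_left)
    also have "card A * (nrm y)\<^sup>2 - card A * ip (avg W A y) y \<ge> card A * (nrm y)\<^sup>2 - card A * (?q * (nrm y)\<^sup>2)"
      using le by (intro diff_left_mono mult_left_mono) simp_all
    also have "card A * (nrm y)\<^sup>2 - card A * (?q * (nrm y)\<^sup>2) = (1 - \<eta>) * (nrm y)\<^sup>2"
      using N by (simp add: field_simps)
    finally have "(1 - \<eta>) * (nrm y)\<^sup>2 \<le> (\<Sum>j\<in>A. (energy W j y)\<^sup>2)" .
    also have "\<dots> = (\<Sum>j\<in>A. (energy W j x)\<^sup>2)" using en by simp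
    finally show "(nrm (P W x - P (W - A) x))\<^sup>2 \<le> 1 / (1 - \<eta>) * (\<Sum>i\<in>A. (energy W i x)\<^sup>2)"
      using \<eta>(2) by (simp add: y_def field_simps)
  qed
qed

text \<open>The block update is the limit of the random-scan iterates, and energies are continuous
  in the norm; this carries over the bound of \<open>energy_avg_pow_outside\<close>, with no trace
  of \<open>card A\<close>.\<close>

lemma energy_block_update:
  assumes A: "finite A" "A \<noteq> {}" "A \<subseteq> W" and x: "x \<in> V" "P W x = x"
    and c: "\<And>j. j \<in> A \<Longrightarrow> energy W j x \<le> c"
    and \<eta>: "\<And>i. i \<in> A \<Longrightarrow> (\<Sum>j\<in>A - {i}. \<epsilon> i j) \<le> \<eta>" "\<eta> < 1"
    and i: "i \<in> W - A" and r: "(\<Sum>j\<in>A. \<epsilon> i j) \<le> r"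
  shows "energy W i (P (W - A) x) \<le> energy W i x + r / (1 - \<eta>) * c"
proof -
  let ?q = "1 - (1 - \<eta>) / card A"
  have N: "0 < card A" using A card_gt_0_iff by blast
  obtain j0 where j0: "j0 \<in> A" using A by blast
  have c0: "0 \<le> c" using c[OF j0] energy_ge_0[OF x(1), of W j0] by linarith
  have "0 \<le> (\<Sum>j\<in>A. \<epsilon> i j)" "0 \<le> (\<Sum>j\<in>A - {j0}. \<epsilon> j0 j)" by (intro sum_nonneg eps_ge_0)+
  then have r0: "0 \<le> r" and \<eta>0: "0 \<le> \<eta>" using r \<eta>(1)[OF j0] by linarith+
  have q: "0 \<le> ?q" "?q < 1" using N \<eta>0 \<eta>(2) by (simp_all add: field_simps)
  obtain C where C: "\<And>n. nrm ((avg W A ^^ n) x - P (W - A) x) \<le> C * ?q ^ n"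
    using avg_pow_converges[OF A x \<eta>] by blast
  let ?b = "energy W i x + r / (1 - \<eta>) * c"
  have "energy W i (P (W - A) x) \<le> ?b + C * ?q ^ n" for n
  proof -
    let ?y = "(avg W A ^^ n) x"
    have "energy W i (?y + (P (W - A) x - ?y)) \<le> energy W i ?y + energy W i (P (W - A) x - ?y)"
      using x by (intro energy_add_le) simp_all
    moreover have "energy W i (P (W - A) x - ?y) \<le> nrm (P (W - A) x - ?y)"
      using x by (intro energy_le_nrm) simp
    moreover have "nrm (P (W - A) x - ?y) = nrm (?y - P (W - A) x)"
      using x by (intro nrm_minus_commute) simp_all
    moreover have "energy W i ?y \<le> energy W i x + r * c / (1 - \<eta>) * (1 - ?q ^ n)"
      by (rule energy_avg_pow_outside[OF A x(1) c \<eta> i r])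
    moreover have "r * c / (1 - \<eta>) * (1 - ?q ^ n) \<le> r * c / (1 - \<eta>)"
      using r0 c0 \<eta>(2) q by (intro mult_left_le) simp_all
    ultimately show ?thesis using C[of n] by simp
  qed
  moreover have "(\<lambda>n. ?b + C * ?q ^ n) \<longlonglongrightarrow> ?b + C * 0"
    using q by (intro tendsto_intros LIMSEQ_power_zero) auto
  ultimately have "energy W i (P (W - A) x) \<le> ?b + C * 0"
    by (intro LIMSEQ_le_const) auto
  then show ?thesis by simp
qed

text \<open>The updates of \<open>A\<close> and then \<open>C\<close> contract energies, in the supremum norm, by the square of
  \<open>r / (1 - \<eta>)\<close>. The crude gap turns this into a bound on the spectral radius, hence on the norm,
  of their symmetric composition.\<close>

lemma decor_blocks:
  assumes A: "finite A" and C: "finite C" and disj: "A \<inter> C = {}" "K \<inter> (A \<union> C) = {}"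
    and \<eta>A: "\<And>i. i \<in> A \<Longrightarrow> (\<Sum>j\<in>A - {i}. \<epsilon> i j) \<le> \<eta>"
    and \<eta>C: "\<And>i. i \<in> C \<Longrightarrow> (\<Sum>j\<in>C - {i}. \<epsilon> i j) \<le> \<eta>" and \<eta>: "\<eta> < 1"
    and AC: "\<And>i. i \<in> A \<Longrightarrow> (\<Sum>j\<in>C. \<epsilon> i j) \<le> r" and CA: "\<And>i. i \<in> C \<Longrightarrow> (\<Sum>j\<in>A. \<epsilon> i j) \<le> r"
  shows "decor A C K (1 - (r / (1 - \<eta>))\<^sup>2)"
proof (rule decorI)
  fix x assume x: "x \<in> V" "P (K \<union> A) x = x" "P K x = 0"
  define \<rho> where "\<rho> = r / (1 - \<eta>)"
  define W where "W = K \<union> A \<union> C"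
  have W: "W - C = K \<union> A" "W - A = K \<union> C" "W - (A \<union> C) = K" "A \<subseteq> W" "C \<subseteq> W"
    using disj by (auto simp: W_def)
  show "(nrm (P (K \<union> C) x))\<^sup>2 \<le> (1 - (1 - (r / (1 - \<eta>))\<^sup>2)) * (nrm x)\<^sup>2"
  proof (cases "A = {} \<or> C = {}")
    case True
    then have "P (K \<union> C) x = 0" using x by auto
    then show ?thesis using x by simp
  next
    case False
    then have ne: "A \<noteq> {}" "C \<noteq> {}" by auto
    obtain i0 where "i0 \<in> A" using ne by blast
    then have "0 \<le> r" using AC[of i0] sum_nonneg[of C "\<epsilon> i0"] eps_ge_0 by force
    then have \<rho>: "0 \<le> \<rho>" using \<eta> by (simp add: \<rho>_def)
    \<comment> \<open>The update of \<open>A\<close> followed by that of \<open>C\<close>; it is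
      symmetric on the range of \<open>P (W - C)\<close>, which contains \<open>x\<close> and its
      iterates.\<close>
    define T where "T = (\<lambda>z. P (W - C) (P (W - A) z))"
    have T: "z \<in> V \<Longrightarrow> T z \<in> V" "z \<in> V \<Longrightarrow> P (W - C) (T z) = T z" for z
      by (simp_all add: T_def)
    have TK: "P K (T z) = P K z" if "z \<in> V" for z
      using that by (simp add: T_def W P_sub)
    have Tn: "(T ^^ n) x \<in> V" "P (W - C) ((T ^^ n) x) = (T ^^ n) x" "P K ((T ^^ n) x) = 0" for n
    proof -
      show V: "(T ^^ n) x \<in> V" for n by (induction n) (simp_all add: x T)
      show "P (W - C) ((T ^^ n) x) = (T ^^ n) x" by (cases n) (use x V T(2) W(1) in auto)
      show "P K ((T ^^ n) x) = 0" by (induction n) (simp_all add: x TK V)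
    qed
    have Tsym: "ip (T z) w = ip z (T w)"
      if "z \<in> V" "P (W - C) z = z" "w \<in> V" "P (W - C) w = w" for z w
      using that P_adj[of z "P (W - A) w" "W - C"] by (simp add: T_def P_adj)
    \<comment> \<open>A vector updated on \<open>C\<close> has no energy in \<open>C\<close>.
      Updating \<open>A\<close> clears \<open>A\<close> and creates at most
      \<open>\<rho> * c\<close> at sites of \<open>C\<close>; updating \<open>C\<close> then creates
      at most \<open>\<rho> * (\<rho> * c)\<close> at sites of \<open>A\<close>.\<close>
    have step: "energy W i (T z) \<le> c * \<rho>\<^sup>2"
      if z: "z \<in> V" "P (W - C) z = z" and c: "\<And>i. i \<in> A \<Longrightarrow> energy W i z \<le> c" and "i \<in> A" for z c i
    proof -
      let ?u = "P (W - A) z"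
      have PW: "P W z = z" "P W ?u = ?u"
        using z P_sup[of z "W - C" W] P_sup[of z "W - A" W] by auto
      have u: "energy W j ?u \<le> \<rho> * c" if j: "j \<in> C" for j
      proof -
        have "energy W j (P (W - A) z) \<le> energy W j z + r / (1 - \<eta>) * c"
          using A ne W z PW c \<eta>A \<eta> CA j disj by (intro energy_block_update) auto
        moreover have "energy W j z = 0" using energy_zero[OF z(1) j, of W] z by simp
        ultimately show ?thesis by (simp add: \<rho>_def)
      qed
      have "energy W i (P (W - C) ?u) \<le> energy W i ?u + r / (1 - \<eta>) * (\<rho> * c)"
        using C ne W z PW u \<eta>C \<eta> AC \<open>i \<in> A\<close> disj by (intro energy_block_update) auto
      moreover have "energy W i ?u = 0" using energy_zero[OF z(1) \<open>i \<in> A\<close>, of W] .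
      ultimately show ?thesis by (simp add: \<rho>_def[symmetric] T_def power2_eq_square ac_simps)
    qed
    have en: "energy W i ((T ^^ n) x) \<le> nrm x * (\<rho>\<^sup>2) ^ n" if "i \<in> A" for i n
      using that
    proof (induction n arbitrary: i)
      case 0
      then show ?case using energy_le_nrm x by simp
    next
      case (Suc n)
      have "energy W i (T ((T ^^ n) x)) \<le> (nrm x * (\<rho>\<^sup>2) ^ n) * \<rho>\<^sup>2"
        using Suc Tn by (intro step) auto
      then show ?case by (simp add: ac_simps)
    qed
    obtain G where G: "G \<ge> 0" "gap_bound W (A \<union> C) G"
      using gap_bound_crude[of "A \<union> C" W] A C W by auto
    have "nrm ((T ^^ 1) x) \<le> \<rho>\<^sup>2 * nrm ((T ^^ 0) x)"
    proof (rule log_convex_growth[of _ "sqrt (G * card (A \<union> C)) * nrm x"])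
      fix n
      let ?z = "(T ^^ n) x"
      note z = Tn[of n]
      show "0 \<le> nrm ?z" using z by simp
      have "(nrm (T ?z))\<^sup>2 = ip ?z (T (T ?z))"
        using z T by (simp add: nrm_power2 Tsym)
      also have "\<dots> \<le> nrm ?z * nrm (T (T ?z))"
        using z T Cauchy_Schwarz[of ?z "T (T ?z)"] by simp
      finally show "(nrm ((T ^^ Suc n) x))\<^sup>2 \<le> nrm ?z * nrm ((T ^^ Suc (Suc n)) x)"
        by simp
      have "P W ?z = ?z" using z P_sup[of ?z "W - C" W] by auto
      then have "(nrm ?z)\<^sup>2 = (nrm (P W ?z - P (W - (A \<union> C)) ?z))\<^sup>2" using z W by simp
      also have "\<dots> \<le> G * (\<Sum>i\<in>A \<union> C. (energy W i ?z)\<^sup>2)"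
        using G z unfolding gap_bound_def by blast
      also have "\<dots> \<le> G * (\<Sum>i\<in>A \<union> C. (nrm x * (\<rho>\<^sup>2) ^ n)\<^sup>2)"
      proof (intro mult_left_mono sum_mono power_mono G)
        fix i assume "i \<in> A \<union> C"
        then show "energy W i ?z \<le> nrm x * (\<rho>\<^sup>2) ^ n"
        proof
          assume "i \<in> C"
          then have "energy W i ?z = 0" using energy_zero[OF z(1), of i C W] z by simp
          then show ?thesis using x by simp
        qed (rule en)
      qed (use z in simp)
      also have "\<dots> = (sqrt (G * card (A \<union> C)) * nrm x * (\<rho>\<^sup>2) ^ n)\<^sup>2"
        using G by (simp add: power_mult_distrib)
      finally show "nrm ?z \<le> sqrt (G * card (A \<union> C)) * nrm x * (\<rho>\<^sup>2) ^ n"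
        by (rule power2_le_imp_le) (use G x in simp)
    qed simp
    then have "nrm (T x) \<le> \<rho>\<^sup>2 * nrm x" by simp
    \<comment> \<open>\<open>W - A\<close> is \<open>K \<union> C\<close>, and \<open>x\<close> is
      fixed by \<open>P (W - C)\<close>; so the squared correlation is controlled by a single
      application of \<open>T\<close>.\<close>
    have "(nrm (P (W - A) x))\<^sup>2 = ip x (T x)"
      using x W P_adj[of x "P (W - A) x" "W - C"] by (simp add: ip_P_self T_def)
    also have "\<dots> \<le> nrm x * nrm (T x)"
      using x T Cauchy_Schwarz[of x "T x"] by simp
    also have "\<dots> \<le> nrm x * (\<rho>\<^sup>2 * nrm x)"
      using \<open>nrm (T x) \<le> \<rho>\<^sup>2 * nrm x\<close> x by (intro mult_left_mono) simp_all
    finally show ?thesis using W by (simp add: \<rho>_def power2_eq_square ac_simps)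
  qed
qed

end

section \<open>The Poincare inequality\<close>

lemma Weierstrass_product_inequality:
  fixes u :: "'a \<Rightarrow> real"
  assumes "\<And>a. a \<in> A \<Longrightarrow> 0 \<le> u a \<and> u a \<le> 1"
  shows "1 - sum u A \<le> (\<Prod>a\<in>A. 1 - u a)"
proof (cases "finite A")
  case True
  then show ?thesis using assms
  proof (induction A)
    case (insert a A)
    have "(\<Prod>a\<in>A. 1 - u a) \<le> 1" using insert.prems by (intro prod_le_1) force
    then have "u a * (\<Prod>a\<in>A. 1 - u a) \<le> u a"
      using insert.prems[of a] by (intro mult_left_le) auto
    moreover have "1 - sum u A \<le> (\<Prod>a\<in>A. 1 - u a)"
      by (rule insert.IH) (rule insert.prems, blast)
    ultimately show ?case using insert.hyps by (simp add: algebra_simps)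
  qed simp
qed simp

context decorrelated_family begin

text \<open>The bound matters when the double sum is small: it makes distant blocks nearly
  independent. Factors are multiplied over \<open>B\<close> for each \<open>a\<close>, then, with
  the roles exchanged by \<open>decor_sym\<close>, over \<open>A\<close>; values at most 1 bound
  their own squares, and the products are linearised.\<close>

lemma decor_finite:
  assumes "finite A" "finite B" "A \<inter> B = {}"
  shows "decor A B K (1 - (\<Sum>a\<in>A. \<Sum>b\<in>B. \<epsilon> a b))"
proof -
  have u: "0 \<le> (\<epsilon> a b)\<^sup>2 \<and> (\<epsilon> a b)\<^sup>2 \<le> 1" "(\<epsilon> a b)\<^sup>2 \<le> \<epsilon> a b" if "a \<in> A" "b \<in> B" for a b
  proof -
    have "a \<noteq> b" using that assms by auto
    then have "0 \<le> \<epsilon> a b" "\<epsilon> a b \<le> 1" using eps_ge_0 eps_less_1[of a b] by auto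
    then show "(\<epsilon> a b)\<^sup>2 \<le> \<epsilon> a b" by (simp add: power2_eq_square mult_left_le)
    with \<open>\<epsilon> a b \<le> 1\<close> show "0 \<le> (\<epsilon> a b)\<^sup>2 \<and> (\<epsilon> a b)\<^sup>2 \<le> 1" by simp
  qed
  define \<delta> where "\<delta> a = (\<Prod>b\<in>B. 1 - (\<epsilon> a b)\<^sup>2)" for a
  have \<delta>: "0 \<le> \<delta> a \<and> \<delta> a \<le> 1" if "a \<in> A" for a
    unfolding \<delta>_def using u[OF that] by (auto intro!: prod_nonneg prod_le_1)
  have \<delta>_ge: "1 - (\<Sum>b\<in>B. \<epsilon> a b) \<le> \<delta> a" if "a \<in> A" for a
  proof -
    have "1 - (\<Sum>b\<in>B. \<epsilon> a b) \<le> 1 - (\<Sum>b\<in>B. (\<epsilon> a b)\<^sup>2)"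
      using u[OF that] by (intro diff_left_mono sum_mono)
    also have "\<dots> \<le> \<delta> a"
      unfolding \<delta>_def using u[OF that] by (intro Weierstrass_product_inequality)
    finally show ?thesis .
  qed
  have "decor B A' K (\<Prod>a\<in>A'. \<delta> a)" if "finite A'" "A' \<subseteq> A" for A'
    using that
  proof (induction A' arbitrary: K)
    case empty
    then show ?case by (simp add: decor_empty)
  next
    case (insert a A')
    have "decor B {a} K (\<delta> a)"
      using decor_single_finite[of B a K] assms insert \<delta>[of a]
      by (intro decor_sym[of "{a}"]) (auto simp: \<delta>_def)
    then have "decor B ({a} \<union> A') K (\<delta> a * (\<Prod>a\<in>A'. \<delta> a))"
      using insert \<delta> by (intro decor_union prod_nonneg) auto
    then show ?case using insert by simp
  qed
  then have "decor A B K (\<Prod>a\<in>A. \<delta> a)"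
    using assms \<delta> by (intro decor_sym[of B A]) (auto intro: prod_le_1)
  moreover have "1 - (\<Sum>a\<in>A. \<Sum>b\<in>B. \<epsilon> a b) \<le> (\<Prod>a\<in>A. \<delta> a)"
  proof -
    have "1 - (\<Sum>a\<in>A. \<Sum>b\<in>B. \<epsilon> a b) \<le> 1 - (\<Sum>a\<in>A. 1 - \<delta> a)"
      using \<delta>_ge by (intro diff_left_mono sum_mono) force
    also have "\<dots> \<le> (\<Prod>a\<in>A. 1 - (1 - \<delta> a))"
      using \<delta> by (intro Weierstrass_product_inequality) force
    finally show ?thesis by simp
  qed
  ultimately show ?thesis by (rule decor_mono)
qed

text \<open>\<open>\<eta> + r < 1\<close> gives \<open>r / (1 - \<eta>) < 1\<close>, hence
  \<open>\<delta> > 0\<close>. Each colour class has a gap by \<open>gap_bound_dilute\<close>;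
  gluing the classes with \<open>two_block\<close> takes as many steps as there are colours, so the
  loss does not depend on \<open>S\<close>.\<close>

lemma uniform_gap_bound:
  fixes col :: "'i \<Rightarrow> 'c"
  assumes fin: "finite (range col)"
    and same: "\<And>i S. finite S \<Longrightarrow> i \<notin> S \<Longrightarrow> col ` S \<subseteq> {col i} \<Longrightarrow> (\<Sum>j\<in>S. \<epsilon> i j) \<le> \<eta>"
    and diff: "\<And>i c S. finite S \<Longrightarrow> c \<noteq> col i \<Longrightarrow> col ` S \<subseteq> {c} \<Longrightarrow> (\<Sum>j\<in>S. \<epsilon> i j) \<le> r"
    and r: "0 \<le> r" "\<eta> + r < 1"
  shows "\<exists>C\<ge>0. \<forall>S. finite S \<longrightarrow> gap_bound UNIV S C"
proof -
  define \<delta> where "\<delta> = 1 - (r / (1 - \<eta>))\<^sup>2"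
  have \<eta>: "\<eta> < 1" using r by linarith
  have "0 \<le> r / (1 - \<eta>)" "r / (1 - \<eta>) < 1" using r by auto
  then have \<delta>: "0 < \<delta>" "\<delta> \<le> 1" by (auto simp: \<delta>_def power_less_one_iff)
  define B where "B S c = {i \<in> S. col i = c}" for S c
  have B_disj: "c \<noteq> d \<Longrightarrow> B S c \<inter> B S d = {}" for S c d by (auto simp: B_def)
  have dec: "decor (B S c) (\<Union>d\<in>\<Delta>. B S d) K (\<delta> ^ card \<Delta>)"
    if "finite \<Delta>" "finite S" "c \<notin> \<Delta>" "K \<inter> B S c = {}" "\<forall>d\<in>\<Delta>. K \<inter> B S d = {}" for S c K \<Delta>
    using that
  proof (induction \<Delta> arbitrary: K)
    case empty
    then show ?case by (simp add: decor_empty)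
  next
    case (insert d \<Delta>)
    have "decor (B S c) (B S d) K \<delta>"
      unfolding \<delta>_def
    proof (rule decor_blocks)
      show "\<And>i. i \<in> B S c \<Longrightarrow> (\<Sum>j\<in>B S c - {i}. \<epsilon> i j) \<le> \<eta>"
        "\<And>i. i \<in> B S d \<Longrightarrow> (\<Sum>j\<in>B S d - {i}. \<epsilon> i j) \<le> \<eta>"
        using insert by (auto intro!: same simp: B_def)
      show "\<And>i. i \<in> B S c \<Longrightarrow> (\<Sum>j\<in>B S d. \<epsilon> i j) \<le> r"
        using insert by (intro diff[of _ d]) (auto simp: B_def)
      show "\<And>i. i \<in> B S d \<Longrightarrow> (\<Sum>j\<in>B S c. \<epsilon> i j) \<le> r"
        using insert by (intro diff[of _ c]) (auto simp: B_def)
    qed (use insert \<eta> B_disj[of c d S] in \<open>auto simp: B_def\<close>)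
    moreover have "decor (B S c) (\<Union>d\<in>\<Delta>. B S d) (K \<union> B S d) (\<delta> ^ card \<Delta>)"
    proof (rule insert.IH)
      have "B S d \<inter> B S c = {}" using insert.prems by (intro B_disj) auto
      then show "(K \<union> B S d) \<inter> B S c = {}" using insert.prems by auto
      have "B S d \<inter> B S d' = {}" if "d' \<in> \<Delta>" for d'
        using insert.hyps that by (intro B_disj) auto
      then show "\<forall>d'\<in>\<Delta>. (K \<union> B S d) \<inter> B S d' = {}" using insert.prems by blast
    qed (use insert in auto)
    ultimately have "decor (B S c) (B S d \<union> (\<Union>d\<in>\<Delta>. B S d)) K (\<delta> * \<delta> ^ card \<Delta>)"
      using \<delta> by (intro decor_union) auto
    then show ?case using insert by simp
  qed
  \<comment> \<open>The constant is chosen before \<open>S\<close> and \<open>x\<close>: the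
    induction runs over colours, with both quantified inside.\<close>
  have "\<exists>C\<ge>0. \<forall>S x. finite S \<longrightarrow> x \<in> V \<longrightarrow> (nrm (P UNIV x - P (UNIV - (\<Union>d\<in>\<Delta>. B S d)) x))\<^sup>2
      \<le> C * (\<Sum>d\<in>\<Delta>. (nrm (P UNIV x - P (UNIV - B S d) x))\<^sup>2)" if "finite \<Delta>" for \<Delta>
    using that
  proof (induction \<Delta>)
    case empty
    then show ?case by (intro exI[of _ 0]) simp
  next
    case (insert c \<Delta>)
    then obtain C where C: "C \<ge> 0"
      "\<And>S x. finite S \<Longrightarrow> x \<in> V \<Longrightarrow> (nrm (P UNIV x - P (UNIV - (\<Union>d\<in>\<Delta>. B S d)) x))\<^sup>2
        \<le> C * (\<Sum>d\<in>\<Delta>. (nrm (P UNIV x - P (UNIV - B S d) x))\<^sup>2)" by auto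
    let ?\<delta> = "\<delta> ^ card \<Delta>"
    have d: "0 < ?\<delta>" "?\<delta> \<le> 1" using \<delta> by (simp_all add: power_le_one)
    have "(nrm (P UNIV x - P (UNIV - (\<Union>d\<in>insert c \<Delta>. B S d)) x))\<^sup>2
        \<le> 10 / ?\<delta> * max C 1 * (\<Sum>d\<in>insert c \<Delta>. (nrm (P UNIV x - P (UNIV - B S d) x))\<^sup>2)"
      if S: "finite S" and x: "x \<in> V" for S x
    proof -
      let ?U = "\<Union>d\<in>\<Delta>. B S d" and ?K = "UNIV - (\<Union>d\<in>insert c \<Delta>. B S d)"
      have "B S c \<inter> B S d = {}" if "d \<in> \<Delta>" for d using insert that by (intro B_disj) auto
      then have eq: "UNIV = ?K \<union> B S c \<union> ?U" "?K \<union> B S c = UNIV - ?U" "?K \<union> ?U = UNIV - B S c"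
        by auto
      have dec': "decor (B S c) ?U ?K ?\<delta>"
        using insert.hyps S by (intro dec) auto
      have "(nrm (P UNIV x - P ?K x))\<^sup>2
          \<le> 10 / ?\<delta> * ((nrm (P UNIV x - P (UNIV - ?U) x))\<^sup>2 + (nrm (P UNIV x - P (UNIV - B S c) x))\<^sup>2)"
        using two_block[OF dec' d x eq(1)] unfolding eq(2,3) .
      also have "\<dots> \<le> 10 / ?\<delta> * (max C 1 * (\<Sum>d\<in>\<Delta>. (nrm (P UNIV x - P (UNIV - B S d) x))\<^sup>2)
          + max C 1 * (nrm (P UNIV x - P (UNIV - B S c) x))\<^sup>2)"
      proof (intro mult_left_mono add_mono)
        show "(nrm (P UNIV x - P (UNIV - ?U) x))\<^sup>2
            \<le> max C 1 * (\<Sum>d\<in>\<Delta>. (nrm (P UNIV x - P (UNIV - B S d) x))\<^sup>2)"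
          by (rule order_trans[OF C(2)[OF S x]]) (intro mult_right_mono sum_nonneg; simp)
        show "(nrm (P UNIV x - P (UNIV - B S c) x))\<^sup>2
            \<le> max C 1 * (nrm (P UNIV x - P (UNIV - B S c) x))\<^sup>2"
          using mult_right_mono[of 1 "max C 1"] by simp
      qed (use d in auto)
      finally show ?thesis using insert.hyps by (simp add: distrib_left ac_simps)
    qed
    moreover have "0 \<le> 10 / ?\<delta> * max C 1" using d by simp
    ultimately show ?case by blast
  qed
  from this[OF fin] obtain C where C: "C \<ge> 0"
    "\<And>S x. finite S \<Longrightarrow> x \<in> V \<Longrightarrow> (nrm (P UNIV x - P (UNIV - (\<Union>d\<in>range col. B S d)) x))\<^sup>2
      \<le> C * (\<Sum>d\<in>range col. (nrm (P UNIV x - P (UNIV - B S d) x))\<^sup>2)" by auto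
  have "gap_bound UNIV S (C * (1 / (1 - \<eta>)))" if S: "finite S" for S
    unfolding gap_bound_def
  proof
    fix x assume x: "x \<in> V"
    have U: "(\<Union>d\<in>range col. B S d) = S" by (auto simp: B_def)
    have "(nrm (P UNIV x - P (UNIV - S) x))\<^sup>2
        \<le> C * (\<Sum>d\<in>range col. (nrm (P UNIV x - P (UNIV - B S d) x))\<^sup>2)"
      using C(2)[OF S x] unfolding U .
    also have "\<dots> \<le> C * (\<Sum>d\<in>range col. 1 / (1 - \<eta>) * (\<Sum>i\<in>B S d. (energy UNIV i x)\<^sup>2))"
    proof (intro mult_left_mono sum_mono C)
      fix d
      have "gap_bound UNIV (B S d) (1 / (1 - \<eta>))"
      proof (rule gap_bound_dilute)
        show "\<And>i. i \<in> B S d \<Longrightarrow> (\<Sum>j\<in>B S d - {i}. \<epsilon> i j) \<le> \<eta>"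
          using S by (auto intro!: same simp: B_def)
      qed (use S \<eta> in \<open>auto simp: B_def\<close>)
      then show "(nrm (P UNIV x - P (UNIV - B S d) x))\<^sup>2
          \<le> 1 / (1 - \<eta>) * (\<Sum>i\<in>B S d. (energy UNIV i x)\<^sup>2)"
        using x by (simp add: gap_bound_def)
    qed
    also have "\<dots> = C * (1 / (1 - \<eta>)) * (\<Sum>d\<in>range col. \<Sum>i\<in>B S d. (energy UNIV i x)\<^sup>2)"
      by (simp add: sum_distrib_left)
    also have "(\<Sum>d\<in>range col. \<Sum>i\<in>B S d. (energy UNIV i x)\<^sup>2) = (\<Sum>i\<in>S. (energy UNIV i x)\<^sup>2)"
      unfolding B_def using S fin by (intro sum.group) auto
    finally show "(nrm (P UNIV x - P (UNIV - S) x))\<^sup>2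
        \<le> C * (1 / (1 - \<eta>)) * (\<Sum>i\<in>S. (energy UNIV i x)\<^sup>2)" .
  qed
  moreover have "0 \<le> C * (1 / (1 - \<eta>))" using C \<eta> by simp
  ultimately show ?thesis by blast
qed

text \<open>A finite block \<open>A\<close> nearly determines \<open>x\<close>, and sites outside a
  large finite \<open>S\<close> know almost nothing about \<open>A\<close>. Hence
  \<open>P (UNIV - S) x\<close> is close to \<open>P {} x\<close>, and the uniform gap for
  \<open>S\<close> bounds the rest.\<close>

lemma Poincare_inequality:
  assumes gap: "\<And>S. finite S \<Longrightarrow> gap_bound UNIV S C" "0 \<le> C"
    and dense: "\<And>J y e. y \<in> V \<Longrightarrow> 0 < e \<Longrightarrow> \<exists>B\<subseteq>J. finite B \<and> nrm (P J y - P B y) \<le> e"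
    and small: "\<And>i e. 0 < e \<Longrightarrow> \<exists>F. finite F \<and> (\<forall>B. finite B \<longrightarrow> B \<inter> F = {} \<longrightarrow> (\<Sum>j\<in>B. \<epsilon> i j) \<le> e)"
    and x: "x \<in> V" and E: "\<And>S. finite S \<Longrightarrow> (\<Sum>i\<in>S. (energy UNIV i x)\<^sup>2) \<le> E"
  shows "(nrm (P UNIV x - P {} x))\<^sup>2 \<le> C * E"
proof -
  have E0: "0 \<le> E" using E[of "{}"] by simp
  have "nrm (P UNIV x - P {} x) \<le> sqrt (C * E) + e" if e: "0 < e" for e
  proof -
    obtain A where A: "finite A" "nrm (P UNIV x - P A x) \<le> e / 3"
      using dense[OF x, of "e / 3" UNIV] e by auto
    define y where "y = P A x"
    have y: "y \<in> V" "P A y = y" "P {} y = P {} x" using x by (simp_all add: y_def P_sub)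
    \<comment> \<open>Chosen so that \<open>sqrt \<tau> * (nrm y + 1) = e / 3\<close>; the added 1
      avoids a division by zero.\<close>
    define \<tau> where "\<tau> = (e / (3 * (nrm y + 1)))\<^sup>2"
    have ny: "0 \<le> nrm y" using y by simp
    have \<tau>: "0 < \<tau>" using e ny by (simp add: \<tau>_def)
    then have "0 < \<tau> / (card A + 1)" by simp
    from small[OF this] obtain F where F: "\<And>a. finite (F a)"
      "\<And>a B. finite B \<Longrightarrow> B \<inter> F a = {} \<Longrightarrow> (\<Sum>j\<in>B. \<epsilon> a j) \<le> \<tau> / (card A + 1)" by metis
    \<comment> \<open>Beyond \<open>S\<close> the correlations with each site of \<open>A\<close>
      sum to at most \<open>\<tau> / (card A + 1)\<close>, and so to at most \<open>\<tau>\<close>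
      over \<open>A\<close>.\<close>
    define S where "S = A \<union> (\<Union>a\<in>A. F a)"
    have S: "finite S" using A F by (simp add: S_def)
    \<comment> \<open>The outside of \<open>S\<close> is replaced by a finite \<open>B\<close>,
      since \<open>decor_finite\<close> compares finite blocks.\<close>
    obtain B where B: "B \<subseteq> UNIV - S" "finite B" "nrm (P (UNIV - S) y - P B y) \<le> e / 3"
      using dense[OF y(1), of "e / 3" "UNIV - S"] e by auto
    \<comment> \<open>The gap is applied to \<open>x\<close>, not to its approximation
      \<open>y\<close>: \<open>E\<close> bounds the energies of \<open>x\<close>, while those of
      \<open>y\<close> are not under control.\<close>
    have "(nrm (P UNIV x - P (UNIV - S) x))\<^sup>2 \<le> C * E"
    proof -
      have "(nrm (P UNIV x - P (UNIV - S) x))\<^sup>2 \<le> C * (\<Sum>i\<in>S. (energy UNIV i x)\<^sup>2)"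
        using gap(1)[OF S] x by (simp add: gap_bound_def)
      also have "\<dots> \<le> C * E" using gap E S by (intro mult_left_mono)
      finally show ?thesis .
    qed
    then have "sqrt ((nrm (P UNIV x - P (UNIV - S) x))\<^sup>2) \<le> sqrt (C * E)" by (rule real_sqrt_le_mono)
    then have 1: "nrm (P UNIV x - P (UNIV - S) x) \<le> sqrt (C * E)" using x by simp
    have "P (UNIV - S) x - P (UNIV - S) y = P (UNIV - S) (P UNIV x - P A x)"
      using x by (simp add: P_diff P_sub y_def)
    then have 2: "nrm (P (UNIV - S) x - P (UNIV - S) y) \<le> e / 3"
      using nrm_P_le[of "P UNIV x - P A x" "UNIV - S"] A x by simp
    have 3: "nrm (P B y - P {} y) \<le> e / 3"
    proof -
      let ?z = "y - P {} y"
      have z: "?z \<in> V" "P ({} \<union> A) ?z = ?z" "P {} ?z = 0" using y(1,2) by (simp_all add: P_diff P_sup)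
      have "(\<Sum>a\<in>A. \<Sum>b\<in>B. \<epsilon> a b) \<le> (\<Sum>a\<in>A. \<tau> / (card A + 1))"
        using B by (intro sum_mono F) (auto simp: S_def)
      also have "\<dots> \<le> \<tau>" using \<tau> by (simp add: field_simps)
      finally have "decor A B {} (1 - \<tau>)"
        using A B by (intro decor_mono[OF decor_finite]) (auto simp: S_def)
      from decor_nrm[OF this z] have "(nrm (P B ?z))\<^sup>2 \<le> \<tau> * (nrm ?z)\<^sup>2" by simp
      also have "\<dots> \<le> \<tau> * (nrm y + 1)\<^sup>2"
        using nrm_compl_P_le[of y "{}"] x y \<tau> by (intro mult_left_mono power_mono) auto
      also have "\<dots> = (e / (3 * (nrm y + 1)) * (nrm y + 1))\<^sup>2"
        unfolding \<tau>_def by (rule power_mult_distrib[symmetric])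
      also have "e / (3 * (nrm y + 1)) * (nrm y + 1) = e / 3"
        using ny nonzero_mult_divide_mult_cancel_right[of "nrm y + 1" e 3] by simp
      finally have "nrm (P B ?z) \<le> e / 3" by (rule power2_le_imp_le) (use e in simp)
      then show ?thesis using x y by (simp add: P_diff P_sup)
    qed
    have "P UNIV x - P {} x = (P UNIV x - P (UNIV - S) x) + (P (UNIV - S) x - P (UNIV - S) y)
        + (P (UNIV - S) y - P B y) + (P B y - P {} y)" using y by simp
    also have "nrm \<dots> \<le> nrm (P UNIV x - P (UNIV - S) x) + nrm (P (UNIV - S) x - P (UNIV - S) y)
        + nrm (P (UNIV - S) y - P B y) + nrm (P B y - P {} y)"
      using x y by (intro order_trans[OF nrm_triangle] add_mono order_refl) simp_all
    finally show ?thesis using 1 2 3 B(3) by linarith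
  qed
  then have "nrm (P UNIV x - P {} x) \<le> sqrt (C * E)" by (rule field_le_epsilon)
  then have "(nrm (P UNIV x - P {} x))\<^sup>2 \<le> (sqrt (C * E))\<^sup>2" using x by (intro power_mono) simp_all
  then show ?thesis using gap E0 by simp
qed

end

section \<open>Sparse sublattices\<close>

lemma summable_on_small_tail:
  fixes \<epsilon> :: "'a \<Rightarrow> real"
  assumes "\<epsilon> summable_on UNIV" "\<And>z. 0 \<le> \<epsilon> z" "0 < e"
  shows "\<exists>F. finite F \<and> (\<forall>B. finite B \<longrightarrow> B \<inter> F = {} \<longrightarrow> sum \<epsilon> B \<le> e)"
proof -
  obtain F where F: "finite F" "dist (sum \<epsilon> F) (infsum \<epsilon> UNIV) \<le> e"
    using infsum_finite_approximation[OF assms(1,3)] by auto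
  have "sum \<epsilon> B \<le> e" if "finite B" "B \<inter> F = {}" for B
  proof -
    have "sum \<epsilon> B + sum \<epsilon> F = sum \<epsilon> (B \<union> F)" using that F by (simp add: sum.union_disjoint)
    also have "\<dots> \<le> infsum \<epsilon> UNIV" using that F assms by (intro finite_sum_le_infsum) auto
    finally show ?thesis using F by (simp add: dist_real_def)
  qed
  then show ?thesis using F by blast
qed

lemma finite_vec_components:
  assumes "finite A"
  shows "finite {v :: 'a ^ 'n. \<forall>l. v $ l \<in> A}"
proof (rule finite_subset)
  show "{v :: 'a ^ 'n. \<forall>l. v $ l \<in> A} \<subseteq> vec_lambda ` (UNIV \<rightarrow>\<^sub>E A)"
  proof
    fix v :: "'a ^ 'n" assume "v \<in> {v. \<forall>l. v $ l \<in> A}"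
    then have "($) v \<in> UNIV \<rightarrow>\<^sub>E A" "v = vec_lambda (($) v)" by auto
    then show "v \<in> vec_lambda ` (UNIV \<rightarrow>\<^sub>E A)" by blast
  qed
qed (use assms in \<open>intro finite_imageI finite_PiE; simp\<close>)

text \<open>The colours are the cosets of \<open>k \<int>\<^sup>n\<close> for a large \<open>k\<close>. Outside a finite set \<open>F\<close> the
  function \<open>\<epsilon>\<close> has a small sum, and a coset meets \<open>i + F\<close> in at most one point, which
  contributes at most \<open>max \<epsilon> < 1\<close> to the sum over the coset.\<close>

lemma lattice_colouring:
  fixes \<epsilon> :: "int ^ 'n \<Rightarrow> real"
  assumes nonneg: "\<And>z. 0 \<le> \<epsilon> z" and less: "\<forall>z. z \<noteq> 0 \<longrightarrow> \<epsilon> z < 1" and sm: "\<epsilon> summable_on UNIV"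
  shows "\<exists>(col :: int ^ 'n \<Rightarrow> int ^ 'n) \<eta> r. finite (range col) \<and> \<eta> + r < 1 \<and> 0 \<le> r \<and>
    (\<forall>i S. finite S \<longrightarrow> i \<notin> S \<longrightarrow> col ` S \<subseteq> {col i} \<longrightarrow> (\<Sum>j\<in>S. \<epsilon> (j - i)) \<le> \<eta>) \<and>
    (\<forall>i c S. finite S \<longrightarrow> c \<noteq> col i \<longrightarrow> col ` S \<subseteq> {c} \<longrightarrow> (\<Sum>j\<in>S. \<epsilon> (j - i)) \<le> r)"
proof -
  obtain F0 where F0: "finite F0" "\<And>B. finite B \<Longrightarrow> B \<inter> F0 = {} \<Longrightarrow> sum \<epsilon> B \<le> 1 / 2"
    using summable_on_small_tail[OF sm nonneg, of "1 / 2"] by auto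
  \<comment> \<open>Off \<open>F0\<close> each value is at most 1/2, and \<open>F0 - {0}\<close> is
    finite; so one \<open>m < 1\<close> bounds all values off the origin.\<close>
  define m where "m = Max (insert (1 / 2) (\<epsilon> ` (F0 - {0})))"
  have m: "m < 1" "0 \<le> m"
  proof -
    have "finite (insert (1 / 2) (\<epsilon> ` (F0 - {0})))" using F0 by simp
    then show "m < 1" unfolding m_def using less by (subst Max_less_iff) auto
    have "1 / 2 \<le> m" unfolding m_def using F0 by (intro Max_ge) auto
    then show "0 \<le> m" by simp
  qed
  have \<epsilon>m: "\<epsilon> z \<le> m" if "z \<noteq> 0" for z
  proof (cases "z \<in> F0")
    case True
    then show ?thesis unfolding m_def using F0 that by (intro Max_ge) auto
  next
    case False
    then have "\<epsilon> z \<le> 1 / 2" using F0(2)[of "{z}"] by simp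
    also have "\<dots> \<le> m" unfolding m_def using F0 by (intro Max_ge) auto
    finally show ?thesis .
  qed
  \<comment> \<open>One third, so that \<open>\<eta> + r = m + 2 * \<eta>\<close> stays below 1 for
    \<open>r = m + \<eta>\<close>.\<close>
  define \<eta> where "\<eta> = (1 - m) / 3"
  have "0 < \<eta>" using m by (simp add: \<eta>_def)
  from summable_on_small_tail[OF sm nonneg this]
  obtain F where F: "finite F" "\<And>B. finite B \<Longrightarrow> B \<inter> F = {} \<Longrightarrow> sum \<epsilon> B \<le> \<eta>" by auto
  define R where "R = (\<Sum>z\<in>F. \<Sum>l\<in>UNIV. \<bar>z $ l\<bar>)"
  have R: "\<bar>z $ l\<bar> \<le> R" if "z \<in> F" for z l
  proof -
    have "\<bar>z $ l\<bar> \<le> (\<Sum>l\<in>UNIV. \<bar>z $ l\<bar>)" by (intro member_le_sum) auto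
    also have "\<dots> \<le> R" unfolding R_def using that F by (intro member_le_sum sum_nonneg) auto
    finally show ?thesis .
  qed
  have R0: "0 \<le> R" unfolding R_def by (intro sum_nonneg) auto
  \<comment> \<open>Two points of a translate of \<open>F\<close> differ by at most
    \<open>2 * R\<close> in every coordinate, so equal residues modulo \<open>2 * R + 1\<close>
    force equality.\<close>
  define k where "k = 2 * R + 1"
  define col :: "int ^ 'n \<Rightarrow> int ^ 'n" where "col i = (\<chi> l. i $ l mod k)" for i
  have col_eq: "i = j" if "col i = col j" "\<And>l. \<bar>i $ l - j $ l\<bar> < k" for i j
  proof -
    have "i $ l = j $ l" for l
    proof -
      have "i $ l mod k = j $ l mod k"
        using arg_cong[OF that(1), of "\<lambda>v. v $ l"] by (simp add: col_def)
      then have dvd: "k dvd \<bar>i $ l - j $ l\<bar>" by (simp add: mod_eq_dvd_iff)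
      show ?thesis
      proof (rule ccontr)
        assume "i $ l \<noteq> j $ l"
        then have "0 < \<bar>i $ l - j $ l\<bar>" by simp
        then show False using zdvd_not_zless[OF _ that(2)[of l]] dvd by blast
      qed
    qed
    then show ?thesis by (simp add: vec_eq_iff)
  qed
  have "0 < k" using R0 by (simp add: k_def)
  then have "range col \<subseteq> {v. \<forall>l. v $ l \<in> {0..<k}}" by (auto simp: col_def)
  then have fin: "finite (range col)" using finite_vec_components[of "{0..<k}"] finite_subset by blast
  have shift: "(\<Sum>j\<in>S. \<epsilon> (j - i)) = sum \<epsilon> ((\<lambda>j. j - i) ` S)" for S i
    by (subst sum.reindex) (auto simp: inj_on_def)
  show ?thesis
  proof (rule exI[of _ col], rule exI[of _ \<eta>], rule exI[of _ "m + \<eta>"], intro conjI allI impI)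
    show "finite (range col)" by fact
    show "0 \<le> m + \<eta>" "\<eta> + (m + \<eta>) < 1" using m by (auto simp: \<eta>_def field_simps)
    fix i :: "int ^ 'n" and S :: "(int ^ 'n) set" assume S: "finite S"
    show "(\<Sum>j\<in>S. \<epsilon> (j - i)) \<le> \<eta>" if "i \<notin> S" "col ` S \<subseteq> {col i}"
      unfolding shift
    proof (rule F(2))
      have "j - i \<notin> F" if "j \<in> S" for j
      proof
        assume "j - i \<in> F"
        then have "\<bar>j $ l - i $ l\<bar> < k" for l using R[of "j - i" l] R0 by (simp add: k_def)
        moreover have "col j = col i" using that \<open>col ` S \<subseteq> {col i}\<close> by auto
        ultimately have "j = i" by (intro col_eq[of j i])
        then show False using that \<open>i \<notin> S\<close> by simp
      qed
      then show "(\<lambda>j. j - i) ` S \<inter> F = {}" by auto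
    qed (use S in simp)
    show "(\<Sum>j\<in>S. \<epsilon> (j - i)) \<le> m + \<eta>" if c: "c \<noteq> col i" "col ` S \<subseteq> {c}" for c
    proof -
      let ?T = "(\<lambda>j. j - i) ` S"
      have uniq: "z = w" if zw: "z \<in> ?T \<inter> F" "w \<in> ?T \<inter> F" for z w
      proof -
        have "col (z + i) = c" "col (w + i) = c" using zw c(2) by (auto simp: image_subset_iff)
        then have "col (z + i) = col (w + i)" by simp
        moreover have "\<bar>(z + i) $ l - (w + i) $ l\<bar> < k" for l
          using R[of z l] R[of w l] zw by (simp add: k_def)
        ultimately have "z + i = w + i" by (rule col_eq)
        then show ?thesis by (rule add_right_imp_eq)
      qed
      have "sum \<epsilon> (?T \<inter> F) \<le> m"
      proof (cases "?T \<inter> F = {}")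
        case False
        then obtain z where z: "z \<in> ?T \<inter> F" by blast
        then have "?T \<inter> F = {z}" using uniq by blast
        \<comment> \<open>The colour \<open>c\<close> of the sites in \<open>S\<close> is not that
          of \<open>i\<close>, so the displacement cannot be 0 and its value is at most
          \<open>m\<close>.\<close>
        moreover have "z \<noteq> 0" using z c(2) c(1) by force
        ultimately show ?thesis using \<epsilon>m by simp
      qed (use m in simp)
      moreover have "sum \<epsilon> (?T - F) \<le> \<eta>" using S by (intro F) auto
      moreover have "sum \<epsilon> ?T = sum \<epsilon> (?T \<inter> F) + sum \<epsilon> (?T - F)"
        using S by (intro sum.Int_Diff) auto
      ultimately show ?thesis unfolding shift by linarith
    qed
  qed
qed

section \<open>The Hilbert space of square-integrable functions\<close>

instantiation "fun" :: (type, real_vector) real_vector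
begin

definition "scaleR c f = (\<lambda>x. c *\<^sub>R f x)"

instance
  by standard (simp_all add: scaleR_fun_def plus_fun_def algebra_simps)

end

definition L2 :: "'a measure \<Rightarrow> ('a \<Rightarrow> real) set" where
  "L2 M = {f \<in> borel_measurable M. integrable M (\<lambda>\<omega>. (f \<omega>)\<^sup>2)}"

text \<open>A function is represented by the functional it defines on \<open>L\<^sup>2\<close>, so that functions equal almost
  everywhere become equal.\<close>

definition L2_dual :: "'a measure \<Rightarrow> ('a \<Rightarrow> real) \<Rightarrow> (('a \<Rightarrow> real) \<Rightarrow> real)" where
  "L2_dual M f = (\<lambda>g. if g \<in> L2 M then \<integral>\<omega>. f \<omega> * g \<omega> \<partial>M else 0)"

definition L2_rep :: "'a measure \<Rightarrow> (('a \<Rightarrow> real) \<Rightarrow> real) \<Rightarrow> 'a \<Rightarrow> real" where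
  "L2_rep M \<phi> = (SOME f. f \<in> L2 M \<and> L2_dual M f = \<phi>)"

text \<open>Evaluating \<open>\<phi>\<close> at a representative of \<open>\<psi>\<close> makes
  linearity in \<open>\<phi>\<close> immediate; for functionals coming from \<open>L2 M\<close> this
  is the usual integral, see \<open>L2_ip_dual\<close>.\<close>

definition L2_ip :: "'a measure \<Rightarrow> (('a \<Rightarrow> real) \<Rightarrow> real) \<Rightarrow> (('a \<Rightarrow> real) \<Rightarrow> real) \<Rightarrow> real" where
  "L2_ip M \<phi> \<psi> = \<phi> (L2_rep M \<psi>)"

definition L2_proj :: "'a measure \<Rightarrow> 'a measure \<Rightarrow> (('a \<Rightarrow> real) \<Rightarrow> real) \<Rightarrow> (('a \<Rightarrow> real) \<Rightarrow> real)" where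
  "L2_proj M F \<phi> = L2_dual M (real_cond_exp M F (L2_rep M \<phi>))"

lemma L2_measurable [measurable_dest]: "f \<in> L2 M \<Longrightarrow> f \<in> borel_measurable M"
  by (simp add: L2_def)

lemma L2_square_integrable: "f \<in> L2 M \<Longrightarrow> integrable M (\<lambda>\<omega>. (f \<omega>)\<^sup>2)"
  by (simp add: L2_def)

lemma L2_mult_integrable:
  assumes "f \<in> L2 M" "g \<in> L2 M"
  shows "integrable M (\<lambda>\<omega>. f \<omega> * g \<omega>)"
proof (rule Bochner_Integration.integrable_bound[of _ "\<lambda>\<omega>. (f \<omega>)\<^sup>2 + (g \<omega>)\<^sup>2"])
  show "AE \<omega> in M. norm (f \<omega> * g \<omega>) \<le> norm ((f \<omega>)\<^sup>2 + (g \<omega>)\<^sup>2)"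
  proof (rule AE_I2)
    fix \<omega>
    have "2 * (\<bar>f \<omega>\<bar> * \<bar>g \<omega>\<bar>) \<le> (f \<omega>)\<^sup>2 + (g \<omega>)\<^sup>2"
      using sum_squares_bound[of "\<bar>f \<omega>\<bar>" "\<bar>g \<omega>\<bar>"] by simp
    moreover have "0 \<le> \<bar>f \<omega>\<bar> * \<bar>g \<omega>\<bar>" by simp
    ultimately show "norm (f \<omega> * g \<omega>) \<le> norm ((f \<omega>)\<^sup>2 + (g \<omega>)\<^sup>2)"
      unfolding real_norm_def abs_mult by linarith
  qed
qed (use assms in \<open>auto simp: L2_def\<close>)

lemma L2_add: "f \<in> L2 M \<Longrightarrow> g \<in> L2 M \<Longrightarrow> (\<lambda>\<omega>. f \<omega> + g \<omega>) \<in> L2 M"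
  using L2_mult_integrable[of f M g] by (auto simp: L2_def power2_sum mult.assoc)

lemma L2_cmult: "f \<in> L2 M \<Longrightarrow> (\<lambda>\<omega>. c * f \<omega>) \<in> L2 M"
  by (auto simp: L2_def power_mult_distrib)

lemma L2_diff: "f \<in> L2 M \<Longrightarrow> g \<in> L2 M \<Longrightarrow> (\<lambda>\<omega>. f \<omega> - g \<omega>) \<in> L2 M"
  using L2_add[of f M "\<lambda>\<omega>. (-1) * g \<omega>"] L2_cmult[of g M "-1"] by simp

lemma L2_dual_add:
  assumes "f \<in> L2 M" "g \<in> L2 M"
  shows "L2_dual M (\<lambda>\<omega>. f \<omega> + g \<omega>) = L2_dual M f + L2_dual M g"
  using assms by (auto simp: L2_dual_def plus_fun_def fun_eq_iff distrib_right L2_mult_integrable)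

lemma L2_dual_cmult: "f \<in> L2 M \<Longrightarrow> L2_dual M (\<lambda>\<omega>. c * f \<omega>) = c *\<^sub>R L2_dual M f"
  by (auto simp: L2_dual_def scaleR_fun_def fun_eq_iff mult.assoc)

lemma L2_dual_zero: "L2_dual M (\<lambda>_. 0) = 0"
  by (auto simp: L2_dual_def zero_fun_def)

lemma L2_dual_diff:
  assumes "f \<in> L2 M" "g \<in> L2 M"
  shows "L2_dual M (\<lambda>\<omega>. f \<omega> - g \<omega>) = L2_dual M f - L2_dual M g"
  using assms by (auto simp: L2_dual_def fun_diff_def fun_eq_iff left_diff_distrib L2_mult_integrable)

text \<open>Tested on \<open>f - g\<close>, equal functionals give a vanishing integral of its
  square. Conversely, functionals of almost everywhere equal functions also agree outside
  \<open>L2 M\<close>, where both have the default value 0.\<close>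

lemma L2_dual_eq_iff:
  assumes "f \<in> L2 M" "g \<in> L2 M"
  shows "L2_dual M f = L2_dual M g \<longleftrightarrow> (AE \<omega> in M. f \<omega> = g \<omega>)"
proof
  assume eq: "L2_dual M f = L2_dual M g"
  define h where "h = (\<lambda>\<omega>. f \<omega> - g \<omega>)"
  have h: "h \<in> L2 M" using assms by (simp add: h_def L2_diff)
  have "(\<integral>\<omega>. (h \<omega>)\<^sup>2 \<partial>M) = L2_dual M f h - L2_dual M g h"
    using assms h by (simp add: L2_dual_def power2_eq_square h_def left_diff_distrib L2_mult_integrable L2_diff)
  then have "(\<integral>\<omega>. (h \<omega>)\<^sup>2 \<partial>M) = 0" using eq by simp
  then have "AE \<omega> in M. (h \<omega>)\<^sup>2 = 0"
    using integral_nonneg_eq_0_iff_AE[of M "\<lambda>\<omega>. (h \<omega>)\<^sup>2"] h by (simp add: L2_def)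
  then show "AE \<omega> in M. f \<omega> = g \<omega>" by (simp add: h_def)
next
  assume "AE \<omega> in M. f \<omega> = g \<omega>"
  then have "(\<integral>\<omega>. f \<omega> * h \<omega> \<partial>M) = (\<integral>\<omega>. g \<omega> * h \<omega> \<partial>M)" if "h \<in> L2 M" for h
    using assms that by (intro integral_cong_AE) (auto simp: L2_def)
  then show "L2_dual M f = L2_dual M g" by (auto simp: L2_dual_def)
qed

lemma L2_rep:
  assumes "f \<in> L2 M"
  shows "L2_rep M (L2_dual M f) \<in> L2 M" "AE \<omega> in M. L2_rep M (L2_dual M f) \<omega> = f \<omega>"
proof -
  have *: "L2_rep M (L2_dual M f) \<in> L2 M \<and> L2_dual M (L2_rep M (L2_dual M f)) = L2_dual M f"
    unfolding L2_rep_def using assms by (intro someI_ex[of "\<lambda>g. g \<in> L2 M \<and> L2_dual M g = L2_dual M f"]) blast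
  then show "L2_rep M (L2_dual M f) \<in> L2 M" by simp
  show "AE \<omega> in M. L2_rep M (L2_dual M f) \<omega> = f \<omega>"
    using * assms L2_dual_eq_iff by blast
qed

lemma L2_ip_dual:
  assumes "f \<in> L2 M" "g \<in> L2 M"
  shows "L2_ip M (L2_dual M f) (L2_dual M g) = (\<integral>\<omega>. f \<omega> * g \<omega> \<partial>M)"
  unfolding L2_ip_def L2_dual_def[of M f] using L2_rep[OF assms(2)] assms
  by (auto intro!: integral_cong_AE simp: L2_measurable)

context prob_space begin

lemma L2_const [simp]: "(\<lambda>_. c) \<in> L2 M"
  by (simp add: L2_def)

lemma L2_integrable: "f \<in> L2 M \<Longrightarrow> integrable M f"
  by (rule square_integrable_imp_integrable) (simp_all add: L2_def)

lemma L2_cond_exp: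
  assumes F: "subalgebra M F" and f: "f \<in> L2 M"
  shows "real_cond_exp M F f \<in> L2 M"
proof -
  interpret finite_measure_subalgebra M F by unfold_locales fact
  have "integrable M (\<lambda>\<omega>. (real_cond_exp M F f \<omega>)\<^sup>2)"
  proof (rule integrable_convex_cond_exp[where I = UNIV and q = "\<lambda>x. x\<^sup>2"])
    show "convex_on UNIV (\<lambda>x::real. x\<^sup>2)"
      by (rule convex_power2)
  qed (use f L2_integrable[OF f] in \<open>auto simp: L2_def\<close>)
  then show ?thesis by (simp add: L2_def)
qed

text \<open>Both sides equal the integral of the product of the two conditional
  expectations.\<close>

lemma cond_exp_adj:
  assumes F: "subalgebra M F" and f: "f \<in> L2 M" and g: "g \<in> L2 M"
  shows "(\<integral>\<omega>. real_cond_exp M F f \<omega> * g \<omega> \<partial>M) = (\<integral>\<omega>. f \<omega> * real_cond_exp M F g \<omega> \<partial>M)"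
proof -
  interpret finite_measure_subalgebra M F by unfold_locales fact
  have "(\<integral>\<omega>. real_cond_exp M F u \<omega> * v \<omega> \<partial>M) = (\<integral>\<omega>. real_cond_exp M F u \<omega> * real_cond_exp M F v \<omega> \<partial>M)"
    if "u \<in> L2 M" "v \<in> L2 M" for u v
    using that by (intro real_cond_exp_intg(2)[symmetric] L2_mult_integrable L2_cond_exp F) (auto simp: L2_measurable)
  from this[OF f g] this[OF g f] show ?thesis by (simp add: mult.commute)
qed

lemma L2_proj_dual:
  assumes F: "subalgebra M F" and f: "f \<in> L2 M"
  shows "L2_proj M F (L2_dual M f) = L2_dual M (real_cond_exp M F f)"
proof -
  interpret finite_measure_subalgebra M F by unfold_locales fact
  note r = L2_rep[OF f]
  have "AE \<omega> in M. real_cond_exp M F (L2_rep M (L2_dual M f)) \<omega> = real_cond_exp M F f \<omega>"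
    using r f by (intro real_cond_exp_cong) (auto simp: L2_measurable)
  then show ?thesis
    unfolding L2_proj_def using L2_dual_eq_iff L2_cond_exp[OF F] r f by blast
qed

end

section \<open>Conditional expectations given sets of coordinates as a projection family\<close>

locale random_system = prob_space M for M :: "'a measure" +
  fixes N :: "'i \<Rightarrow> 'b measure" and X :: "'i \<Rightarrow> 'a \<Rightarrow> 'b"
  assumes X_measurable: "\<And>i. X i \<in> measurable M (N i)"
begin

abbreviation \<A> :: "'i set \<Rightarrow> 'a measure" where "\<A> \<equiv> alg_of M N X"

abbreviation \<V> :: "'i \<Rightarrow> 'a measure" where "\<V> i \<equiv> vimage_algebra (space M) (X i) (N i)"

lemma subalgebra_\<A>: "subalgebra M (\<A> K)"
  by (intro subalgebra_alg_of X_measurable)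

lemma sets_\<V>_subset: "sets (\<V> i) \<subseteq> sets M"
  using subalgebra_vimage_algebra[OF X_measurable[of i]] by (simp add: subalgebra_def)

lemma generator_subset: "(\<Union>k\<in>K. sets (\<V> k)) \<subseteq> Pow (space M)"
  using sets_\<V>_subset sets.sets_into_space by blast

lemma space_\<A> [simp]: "space (\<A> K) = space M"
  using subalgebra_\<A> by (simp add: subalgebra_def)

lemma sets_\<A>: "sets (\<A> K) = sigma_sets (space M) (\<Union>k\<in>K. sets (\<V> k))"
  unfolding alg_of_def using generator_subset by (rule sets_measure_of)

lemma sets_\<A>_mono: "K \<subseteq> L \<Longrightarrow> sets (\<A> K) \<subseteq> sets (\<A> L)"
  unfolding sets_\<A> by (intro sigma_sets_subseteq UN_mono) auto

lemma subalgebra_\<A>_mono: "K \<subseteq> L \<Longrightarrow> subalgebra (\<A> L) (\<A> K)"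
  using sets_\<A>_mono by (simp add: subalgebra_def)

text \<open>\<open>corr_bound\<close> speaks of the join of two algebras, \<open>decor\<close> of
  one more site in the conditioning set; this matches them.\<close>

lemma sets_join_\<A>: "sets (join_alg (\<V> i) (\<A> K)) = sets (\<A> (insert i K))"
proof -
  have "sets (join_alg (\<V> i) (\<A> K))
      = sigma_sets (space M) (sets (\<V> i) \<union> sets (\<A> K))"
    unfolding join_alg_def using sets_\<V>_subset[of i] subalgebra_\<A>[of K]
      sets.sets_into_space[of _ M] by (subst sets_measure_of) (auto simp: subalgebra_def)
  also have "\<dots> = sets (\<A> (insert i K))"
  proof
    have "sets (\<V> i) \<subseteq> sets (\<A> (insert i K))"
      unfolding sets_\<A> by (auto intro: sigma_sets.Basic)
    then have "sets (\<V> i) \<union> sets (\<A> K) \<subseteq> sets (\<A> (insert i K))"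
      using sets_\<A>_mono[of K "insert i K"] by auto
    then show "sigma_sets (space M) (sets (\<V> i) \<union> sets (\<A> K)) \<subseteq> sets (\<A> (insert i K))"
      using sets.sigma_sets_subset[of _ "\<A> (insert i K)"] by simp
    show "sets (\<A> (insert i K)) \<subseteq> sigma_sets (space M) (sets (\<V> i) \<union> sets (\<A> K))"
      unfolding sets_\<A> by (intro sigma_sets_mono') (auto intro: sigma_sets.Basic)
  qed
  finally show ?thesis .
qed

lemma finite_measure_subalgebra_\<A>: "finite_measure_subalgebra M (\<A> K)"
  by unfold_locales (rule subalgebra_\<A>)

abbreviation E :: "'i set \<Rightarrow> ('a \<Rightarrow> real) \<Rightarrow> 'a \<Rightarrow> real" where
  "E K \<equiv> real_cond_exp M (\<A> K)"

lemma E_in_L2 [simp]: "f \<in> L2 M \<Longrightarrow> E K f \<in> L2 M"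
  by (rule L2_cond_exp[OF subalgebra_\<A>])

lemma E_measurable:
  assumes "K \<subseteq> L"
  shows "E K f \<in> borel_measurable (\<A> L)"
  using measurable_from_subalg[OF subalgebra_\<A>_mono[OF assms] borel_measurable_cond_exp] .

lemma dual_E_id:
  assumes "f \<in> L2 M" "f \<in> borel_measurable (\<A> K)"
  shows "L2_dual M (E K f) = L2_dual M f"
proof -
  interpret finite_measure_subalgebra M "\<A> K" by (rule finite_measure_subalgebra_\<A>)
  show ?thesis using assms real_cond_exp_F_meas L2_integrable by (subst L2_dual_eq_iff) auto
qed

lemma proj_dual [simp]: "f \<in> L2 M \<Longrightarrow> L2_proj M (\<A> K) (L2_dual M f) = L2_dual M (E K f)"
  by (rule L2_proj_dual[OF subalgebra_\<A>])

text \<open>Functionals make the form definite: a vector of norm 0 is \<open>0\<close> itself,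
  although its representatives vanish only almost everywhere.\<close>

sublocale projection_family "L2_dual M ` L2 M" "L2_ip M" "\<lambda>K. L2_proj M (\<A> K)"
proof
  let ?V = "L2_dual M ` L2 M"
  show "subspace ?V"
    unfolding subspace_def
  proof (intro conjI ballI allI)
    show "0 \<in> ?V" by (rule image_eqI[of _ _ "\<lambda>_. 0"]) (simp_all add: L2_dual_zero)
    show "x + y \<in> ?V" if "x \<in> ?V" "y \<in> ?V" for x y
      using that by (auto simp: L2_dual_add[symmetric] L2_add)
    show "c *\<^sub>R x \<in> ?V" if "x \<in> ?V" for x c
      using that by (auto simp: L2_dual_cmult[symmetric] L2_cmult)
  qed
  fix x y z :: "('a \<Rightarrow> real) \<Rightarrow> real" and c :: real and K L :: "'i set"
  assume "x \<in> ?V"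
  then obtain f where f: "f \<in> L2 M" "x = L2_dual M f" by auto
  show "L2_ip M (c *\<^sub>R x) z = c * L2_ip M x z"
    by (simp add: L2_ip_def scaleR_fun_def)
  show "0 \<le> L2_ip M x x"
    using f by (simp add: L2_ip_dual)
  show "x = 0" if "L2_ip M x x = 0"
  proof -
    have "AE \<omega> in M. f \<omega> * f \<omega> = 0"
      using that f integral_nonneg_eq_0_iff_AE[of M "\<lambda>\<omega>. f \<omega> * f \<omega>"]
      by (simp add: L2_ip_dual L2_mult_integrable)
    then have "L2_dual M f = L2_dual M (\<lambda>_. 0)" using f by (subst L2_dual_eq_iff) auto
    then show ?thesis using f by (simp add: L2_dual_zero)
  qed
  show "L2_proj M (\<A> K) x \<in> ?V"
    using f by simp
  show "L2_proj M (\<A> K) (c *\<^sub>R x) = c *\<^sub>R L2_proj M (\<A> K) x"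
  proof -
    interpret finite_measure_subalgebra M "\<A> K" by (rule finite_measure_subalgebra_\<A>)
    have "L2_dual M (E K (\<lambda>\<omega>. c * f \<omega>)) = L2_dual M (\<lambda>\<omega>. c * E K f \<omega>)"
      using f L2_integrable by (subst L2_dual_eq_iff) (auto simp: L2_cmult)
    then show ?thesis using f by (simp add: L2_dual_cmult[symmetric] L2_cmult)
  qed
  show "L2_proj M (\<A> K) (L2_proj M (\<A> L) x) = L2_proj M (\<A> K) x" if "K \<subseteq> L"
  proof -
    interpret finite_measure_subalgebra M "\<A> K" by (rule finite_measure_subalgebra_\<A>)
    have "AE \<omega> in M. E K (E L f) \<omega> = E K f \<omega>"
      using f L2_integrable subalgebra_\<A> subalgebra_\<A>_mono[OF that]
      by (intro real_cond_exp_nested_subalg) auto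
    then show ?thesis using f by (simp add: L2_dual_eq_iff)
  qed
  show "L2_proj M (\<A> L) (L2_proj M (\<A> K) x) = L2_proj M (\<A> K) x" if "K \<subseteq> L"
    using f E_measurable[OF that] by (simp add: dual_E_id)
  assume "y \<in> ?V"
  then obtain g where g: "g \<in> L2 M" "y = L2_dual M g" by auto
  show "L2_ip M x y = L2_ip M y x"
    using f g by (simp add: L2_ip_dual mult.commute)
  show "L2_ip M (x + y) z = L2_ip M x z + L2_ip M y z"
    by (simp add: L2_ip_def plus_fun_def)
  show "L2_proj M (\<A> K) (x + y) = L2_proj M (\<A> K) x + L2_proj M (\<A> K) y"
  proof -
    interpret finite_measure_subalgebra M "\<A> K" by (rule finite_measure_subalgebra_\<A>)
    have "L2_dual M (E K (\<lambda>\<omega>. f \<omega> + g \<omega>)) = L2_dual M (\<lambda>\<omega>. E K f \<omega> + E K g \<omega>)"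
      using f g L2_integrable by (subst L2_dual_eq_iff) (auto simp: L2_add)
    then show ?thesis using f g by (simp add: L2_dual_add[symmetric] L2_add)
  qed
  show "L2_ip M (L2_proj M (\<A> K) x) y = L2_ip M x (L2_proj M (\<A> K) y)"
    using f g cond_exp_adj[OF subalgebra_\<A>] by (simp add: L2_ip_dual)
qed

abbreviation Pr :: "'i set \<Rightarrow> (('a \<Rightarrow> real) \<Rightarrow> real) \<Rightarrow> (('a \<Rightarrow> real) \<Rightarrow> real)" where
  "Pr K \<equiv> L2_proj M (\<A> K)"

lemma nrm_dual: "f \<in> L2 M \<Longrightarrow> (nrm (L2_dual M f))\<^sup>2 = (\<integral>\<omega>. (f \<omega>)\<^sup>2 \<partial>M)"
  using nrm_power2[of "L2_dual M f"] by (simp add: L2_ip_dual power2_eq_square)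

lemma sd_le_nrm:
  assumes "f \<in> L2 M"
  shows "sd M f \<le> nrm (L2_dual M f)"
proof -
  have "variance f \<le> (\<integral>\<omega>. (f \<omega>)\<^sup>2 \<partial>M)"
    using assms L2_integrable[OF assms] by (simp add: variance_eq L2_def)
  then have "sd M f \<le> sqrt ((nrm (L2_dual M f))\<^sup>2)"
    unfolding sd_def nrm_dual[OF assms] by (rule real_sqrt_le_mono)
  then show ?thesis using assms by simp
qed

text \<open>The optimal partner of \<open>f\<close> is its conditional expectation \<open>g\<close>:
  the integral of \<open>f * g\<close> is then the squared norm of \<open>g\<close>, and cancelling
  one factor bounds the norm of \<open>g\<close> by \<open>e\<close> times that of
  \<open>f\<close>.\<close>

lemma decor_corr_bound:
  assumes cb: "corr_bound M (\<V> i) (\<V> j) (\<A> K) e" and e: "0 \<le> e"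
  shows "decor {i} {j} K (1 - e\<^sup>2)"
proof (rule decorI)
  fix x assume x: "x \<in> L2_dual M ` L2 M" "Pr (K \<union> {i}) x = x" "Pr K x = 0"
  then obtain f0 where f0: "f0 \<in> L2 M" "x = L2_dual M f0" by auto
  \<comment> \<open>\<open>corr_bound\<close> demands genuine measurability for the join algebras,
    so versions are fixed instead of arguing up to null sets.\<close>
  define f g where "f = E (insert i K) f0" and "g = E (insert j K) f"
  have fg: "f \<in> L2 M" "g \<in> L2 M" using f0 by (simp_all add: f_def g_def)
  have xf: "x = L2_dual M f" using x f0 by (simp add: f_def)
  have "L2_dual M (E K f) = L2_dual M (\<lambda>_. 0)" using x(3) fg by (simp add: xf L2_dual_zero)
  then have f_0: "AE \<omega> in M. E K f \<omega> = 0" using fg by (subst (asm) L2_dual_eq_iff) auto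
  have "L2_dual M (E K g) = Pr K (Pr (insert j K) x)" using fg by (simp add: xf g_def)
  also have "\<dots> = 0" using x P_sub[OF x(1), of K "insert j K"] by auto
  finally have "L2_dual M (E K g) = L2_dual M (\<lambda>_. 0)" by (simp add: L2_dual_zero)
  then have g_0: "AE \<omega> in M. E K g \<omega> = 0" using fg by (subst (asm) L2_dual_eq_iff) auto
  have "f \<in> borel_measurable (\<A> (insert i K))" "g \<in> borel_measurable (\<A> (insert j K))"
    by (simp_all add: f_def g_def)
  then have meas: "f \<in> borel_measurable (join_alg (\<V> i) (\<A> K))" "g \<in> borel_measurable (join_alg (\<V> j) (\<A> K))"
    by (simp_all cong: measurable_cong_sets add: measurable_cong_sets[OF sets_join_\<A> refl])
  have Px: "Pr (K \<union> {j}) x = L2_dual M g" using fg by (simp add: xf g_def)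
  have "(nrm (Pr (K \<union> {j}) x))\<^sup>2 = L2_ip M x (Pr (K \<union> {j}) x)"
    using x(1) by (simp add: ip_P_self)
  also have "\<dots> = (\<integral>\<omega>. f \<omega> * g \<omega> \<partial>M)"
    unfolding Px using fg by (simp add: xf L2_ip_dual)
  also have "\<dots> \<le> e * sd M f * sd M g"
    using cb[unfolded corr_bound_def, rule_format, OF meas] fg f_0 g_0 by (simp add: L2_def)
  also have "\<dots> \<le> e * nrm x * nrm (Pr (K \<union> {j}) x)"
  proof (intro mult_mono)
    show "sd M f \<le> nrm x" "sd M g \<le> nrm (Pr (K \<union> {j}) x)"
      unfolding Px using fg sd_le_nrm by (simp_all add: xf)
    show "0 \<le> sd M g" by (simp add: sd_def)
  qed (use x e in \<open>simp_all add: sd_def\<close>)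
  finally have "nrm (Pr (K \<union> {j}) x) * nrm (Pr (K \<union> {j}) x) \<le> e * nrm x * nrm (Pr (K \<union> {j}) x)"
    by (simp add: power2_eq_square)
  moreover have "0 \<le> nrm (Pr (K \<union> {j}) x)" "0 \<le> e * nrm x" using x e by simp_all
  ultimately have "nrm (Pr (K \<union> {j}) x) \<le> e * nrm x"
    by (cases "nrm (Pr (K \<union> {j}) x) = 0") (simp_all add: mult_le_cancel_right)
  then have "(nrm (Pr (K \<union> {j}) x))\<^sup>2 \<le> (e * nrm x)\<^sup>2"
    using x by (intro power_mono) simp_all
  then show "(nrm (Pr (K \<union> {j}) x))\<^sup>2 \<le> (1 - (1 - e\<^sup>2)) * (nrm x)\<^sup>2"
    by (simp add: power_mult_distrib)
qed

end

section \<open>Approximation by functions of finitely many variables\<close>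

context projection_family begin

text \<open>\<open>P B y\<close> is the point nearest to \<open>y\<close> in the range of
  \<open>P B\<close>, so this is the closure of the vectors that depend on finitely many sites of
  \<open>J\<close>.\<close>

definition finitary :: "'i set \<Rightarrow> 'v set" where
  "finitary J = {y \<in> V. \<forall>e>0. \<exists>B\<subseteq>J. finite B \<and> nrm (y - P B y) \<le> e}"

lemma nrm_compl_antimono:
  assumes "y \<in> V" "B \<subseteq> B'"
  shows "nrm (y - P B' y) \<le> nrm (y - P B y)"
proof -
  have "y - P B' y = (y - P B y) - P B' (y - P B y)" using assms by (simp add: P_diff P_sup)
  then have "nrm (y - P B' y) = nrm ((y - P B y) - P B' (y - P B y))" by (rule arg_cong)
  also have "\<dots> \<le> nrm (y - P B y)" using assms by (intro nrm_compl_P_le) simp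
  finally show ?thesis .
qed

lemma finitary_fixed: "y \<in> V \<Longrightarrow> finite B \<Longrightarrow> B \<subseteq> J \<Longrightarrow> P B y = y \<Longrightarrow> y \<in> finitary J"
  unfolding finitary_def by (force intro: exI[of _ B])

lemma finitary_add:
  assumes "y \<in> finitary J" "z \<in> finitary J"
  shows "y + z \<in> finitary J"
proof -
  have V: "y \<in> V" "z \<in> V" using assms by (auto simp: finitary_def)
  have "\<exists>B\<subseteq>J. finite B \<and> nrm (y + z - P B (y + z)) \<le> e" if "0 < e" for e
  proof -
    have "0 < e / 2" using that by simp
    then obtain B C where B: "B \<subseteq> J" "finite B" "nrm (y - P B y) \<le> e / 2"
      and C: "C \<subseteq> J" "finite C" "nrm (z - P C z) \<le> e / 2"
      using assms unfolding finitary_def by blast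
    have eq: "y + z - P (B \<union> C) (y + z) = (y - P (B \<union> C) y) + (z - P (B \<union> C) z)"
      using V by (simp add: P_add)
    have "nrm (y + z - P (B \<union> C) (y + z)) \<le> nrm (y - P (B \<union> C) y) + nrm (z - P (B \<union> C) z)"
      unfolding eq using V by (intro nrm_triangle) simp_all
    also have "\<dots> \<le> e / 2 + e / 2"
      using B(3) C(3) nrm_compl_antimono[OF V(1), of B "B \<union> C"] nrm_compl_antimono[OF V(2), of C "B \<union> C"]
      by simp
    finally show ?thesis using B C by (intro exI[of _ "B \<union> C"]) simp
  qed
  then show ?thesis using V by (simp add: finitary_def)
qed

lemma finitary_scaleR:
  assumes "y \<in> finitary J"
  shows "c *\<^sub>R y \<in> finitary J"
proof -
  have V: "y \<in> V" using assms by (auto simp: finitary_def)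
  have "\<exists>B\<subseteq>J. finite B \<and> nrm (c *\<^sub>R y - P B (c *\<^sub>R y)) \<le> e" if "0 < e" for e
  proof -
    have "0 < e / (\<bar>c\<bar> + 1)" using that by simp
    then obtain B where B: "B \<subseteq> J" "finite B" "nrm (y - P B y) \<le> e / (\<bar>c\<bar> + 1)"
      using assms unfolding finitary_def by blast
    have "nrm (c *\<^sub>R y - P B (c *\<^sub>R y)) = \<bar>c\<bar> * nrm (y - P B y)"
      using V by (simp add: P_scaleR scaleR_diff_right[symmetric] nrm_scaleR)
    also have "\<dots> \<le> (\<bar>c\<bar> + 1) * (e / (\<bar>c\<bar> + 1))"
      using B V by (intro mult_mono) auto
    also have "\<dots> = e" by simp
    finally show ?thesis using B by blast
  qed
  then show ?thesis using V by (simp add: finitary_def)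
qed

lemma finitary_diff: "y \<in> finitary J \<Longrightarrow> z \<in> finitary J \<Longrightarrow> y - z \<in> finitary J"
  using finitary_add[of y J "(-1) *\<^sub>R z"] finitary_scaleR[of z J "-1"] by simp

lemma finitary_zero: "0 \<in> finitary J"
  by (rule finitary_fixed[of _ "{}"]) simp_all

lemma finitary_sum: "finite A \<Longrightarrow> (\<And>a. a \<in> A \<Longrightarrow> f a \<in> finitary J) \<Longrightarrow> sum f A \<in> finitary J"
proof (induction A rule: finite_induct)
  case (insert a A)
  have "f a + sum f A \<in> finitary J"
    by (intro finitary_add insert.IH) (use insert.prems in blast)+
  then show ?case using insert.hyps by simp
qed (simp add: finitary_zero)

lemma finitary_closed:
  assumes y: "y \<in> V" and z: "\<And>e. 0 < e \<Longrightarrow> \<exists>z\<in>finitary J. nrm (y - z) \<le> e"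
  shows "y \<in> finitary J"
proof -
  have "\<exists>B\<subseteq>J. finite B \<and> nrm (y - P B y) \<le> e" if "0 < e" for e
  proof -
    have e: "0 < e / 2" using that by simp
    obtain z where z: "z \<in> finitary J" "nrm (y - z) \<le> e / 2" using z[OF e] by blast
    then obtain B where B: "B \<subseteq> J" "finite B" "nrm (z - P B z) \<le> e / 2"
      using e unfolding finitary_def by blast
    have V: "z \<in> V" using z by (simp add: finitary_def)
    have eq: "y - P B y = ((y - z) - P B (y - z)) + (z - P B z)" using V y by (simp add: P_diff)
    have "nrm (y - P B y) \<le> nrm ((y - z) - P B (y - z)) + nrm (z - P B z)"
      unfolding eq using V y by (intro nrm_triangle) simp_all
    also have "nrm ((y - z) - P B (y - z)) \<le> nrm (y - z)" using V y by (intro nrm_compl_P_le) simp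
    finally show ?thesis using B z by (intro exI[of _ B]) simp
  qed
  then show ?thesis using y by (simp add: finitary_def)
qed

end

context random_system begin

lemma indicator_L2 [simp]: "A \<in> sets M \<Longrightarrow> (indicator A :: 'a \<Rightarrow> real) \<in> L2 M"
proof -
  assume A: "A \<in> sets M"
  have "(\<lambda>\<omega>. (indicator A \<omega> :: real)\<^sup>2) = indicator A" by (auto simp: indicator_def fun_eq_iff)
  then show ?thesis using A by (simp add: L2_def integrable_real_indicator less_top[symmetric])
qed

lemma nrm_dual_diff:
  "f \<in> L2 M \<Longrightarrow> g \<in> L2 M \<Longrightarrow> (nrm (L2_dual M f - L2_dual M g))\<^sup>2 = (\<integral>\<omega>. (f \<omega> - g \<omega>)\<^sup>2 \<partial>M)"
  by (simp add: L2_dual_diff[symmetric] nrm_dual L2_diff)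

lemma finitary_dual_limit:
  assumes f: "f \<in> L2 M" and g: "\<And>n. g n \<in> L2 M" "\<And>n. L2_dual M (g n) \<in> finitary J"
    and lim: "(\<lambda>n. \<integral>\<omega>. (f \<omega> - g n \<omega>)\<^sup>2 \<partial>M) \<longlonglongrightarrow> 0"
  shows "L2_dual M f \<in> finitary J"
proof (rule finitary_closed)
  show "L2_dual M f \<in> L2_dual M ` L2 M" using f by simp
  fix e :: real assume e: "0 < e"
  then have "0 < e\<^sup>2" by simp
  from order_tendstoD(2)[OF lim this] obtain n where "(\<integral>\<omega>. (f \<omega> - g n \<omega>)\<^sup>2 \<partial>M) < e\<^sup>2"
    by (auto simp: eventually_sequentially)
  then have "(nrm (L2_dual M f - L2_dual M (g n)))\<^sup>2 \<le> e\<^sup>2"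
    using f g by (simp add: nrm_dual_diff)
  then have "nrm (L2_dual M f - L2_dual M (g n)) \<le> e"
    by (rule power2_le_imp_le) (use e in simp)
  then show "\<exists>z\<in>finitary J. nrm (L2_dual M f - z) \<le> e" using g by blast
qed

text \<open>Dynkin's argument: events depending on finitely many sites of \<open>J\<close> form an
  intersection-stable generator, and the claim passes to complements and countable disjoint
  unions.\<close>

lemma finitary_indicator:
  assumes "A \<in> sets (\<A> J)"
  shows "L2_dual M (indicator A) \<in> finitary J"
proof -
  define G where "G = (\<Union>B\<in>{B. finite B \<and> B \<subseteq> J}. sets (\<A> B))"
  have GM: "G \<subseteq> sets M"
    using subalgebra_\<A> by (auto simp: G_def subalgebra_def)
  then have sG: "sigma_sets (space M) G \<subseteq> sets M" by (rule sets.sigma_sets_subset)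
  have stable: "Int_stable G"
  proof (rule Int_stableI)
    fix a b assume "a \<in> G" "b \<in> G"
    then obtain B C where B: "finite B" "B \<subseteq> J" "a \<in> sets (\<A> B)"
      and C: "finite C" "C \<subseteq> J" "b \<in> sets (\<A> C)" by (auto simp: G_def)
    have "a \<in> sets (\<A> (B \<union> C))" "b \<in> sets (\<A> (B \<union> C))"
      using B(3) C(3) sets_\<A>_mono[of B "B \<union> C"] sets_\<A>_mono[of C "B \<union> C"] by auto
    then have "a \<inter> b \<in> sets (\<A> (B \<union> C))" by (rule sets.Int)
    then show "a \<inter> b \<in> G" using B C by (auto simp: G_def intro!: exI[of _ "B \<union> C"])
  qed
  have Pow: "G \<subseteq> Pow (space M)" using GM sets.sets_into_space by blast
  have "A \<in> sigma_sets (space M) G"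
  proof -
    have "(\<Union>k\<in>J. sets (\<V> k)) \<subseteq> G"
    proof safe
      fix k a assume "k \<in> J" "a \<in> sets (\<V> k)"
      then have "a \<in> sets (\<A> {k})" by (auto simp: sets_\<A> intro: sigma_sets.Basic)
      then show "a \<in> G" using \<open>k \<in> J\<close> by (auto simp: G_def intro!: exI[of _ "{k}"])
    qed
    then show ?thesis using assms sigma_sets_mono'[of _ G] unfolding sets_\<A> by blast
  qed
  with stable Pow show ?thesis
  proof (induction rule: sigma_sets_induct_disjoint)
    case (basic A)
    then obtain B where B: "finite B" "B \<subseteq> J" "A \<in> sets (\<A> B)" by (auto simp: G_def)
    have A: "A \<in> sets M" using basic GM by blast
    have "L2_dual M (E B (indicator A)) = L2_dual M (indicator A)"
      using A B by (intro dual_E_id) auto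
    then show ?case using A B by (intro finitary_fixed[of _ B]) simp_all
  next
    case empty
    have "(indicator {} :: 'a \<Rightarrow> real) = (\<lambda>_. 0)" by auto
    then show ?case by (simp only: L2_dual_zero finitary_zero)
  next
    case (compl A)
    then have A: "A \<in> sets M" using sG by blast
    have "L2_dual M (E {} (\<lambda>_. 1)) = L2_dual M (\<lambda>_. 1)" by (rule dual_E_id) auto
    then have one: "L2_dual M (\<lambda>_. 1) \<in> finitary J"
      by (intro finitary_fixed[of _ "{}"]) simp_all
    have "(\<lambda>\<omega>. 1 - indicator A \<omega>) \<in> L2 M" using A by (intro L2_diff) simp_all
    then have "L2_dual M (indicator (space M - A)) = L2_dual M (\<lambda>\<omega>. 1 - indicator A \<omega>)"
      using A by (subst L2_dual_eq_iff) (simp_all add: indicator_def)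
    also have "\<dots> = L2_dual M (\<lambda>_. 1) - L2_dual M (indicator A)"
      using A by (intro L2_dual_diff) simp_all
    finally show ?case by (simp only: finitary_diff[OF one compl(2)])
  next
    case (union A)
    then have A: "A n \<in> sets M" for n using sG by blast
    \<comment> \<open>Partial unions turn the disjoint union into an increasing limit, where the
      squared distance of indicators is a difference of measures tending to 0.\<close>
    define D where "D n = (\<Union>k<n. A k)" for n
    have D: "D n \<in> sets M" for n using A by (auto simp: D_def)
    have fin: "L2_dual M (indicator (D n)) \<in> finitary J" for n
    proof (induction n)
      case 0
      have "(indicator (D 0) :: 'a \<Rightarrow> real) = (\<lambda>_. 0)" by (auto simp: D_def)
      then show ?case by (simp only: L2_dual_zero finitary_zero)
    next
      case (Suc n)
      have "A k \<inter> A n = {}" if "k < n" for k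
        using disjoint_family_onD[OF union(1), of k n] that by simp
      then have "D n \<inter> A n = {}" unfolding D_def by blast
      then have eq: "(indicator (D (Suc n)) :: 'a \<Rightarrow> real) = (\<lambda>\<omega>. indicator (D n) \<omega> + indicator (A n) \<omega>)"
        by (auto simp: D_def lessThan_Suc fun_eq_iff indicator_def)
      show ?case
        unfolding eq L2_dual_add[OF indicator_L2[OF D] indicator_L2[OF A]]
        using Suc union(3) by (rule finitary_add)
    qed
    have U: "(\<Union>n. A n) = (\<Union>n. D n)" by (auto simp: D_def)
    have UM: "(\<Union>n. D n) \<in> sets M" using D by auto
    have "(\<lambda>n. measure M (D n)) \<longlonglongrightarrow> measure M (\<Union>n. D n)"
      using D by (intro finite_Lim_measure_incseq) (auto simp: D_def incseq_def intro: less_le_trans)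
    then have "(\<lambda>n. measure M (\<Union>n. D n) - measure M (D n)) \<longlonglongrightarrow> measure M (\<Union>n. D n) - measure M (\<Union>n. D n)"
      by (intro tendsto_diff tendsto_const)
    moreover have "(\<integral>\<omega>. (indicator (\<Union>n. D n) \<omega> - indicator (D n) \<omega>)\<^sup>2 \<partial>M)
        = measure M (\<Union>n. D n) - measure M (D n)" for n
    proof -
      have "(\<integral>\<omega>. (indicator (\<Union>n. D n) \<omega> - indicator (D n) \<omega> :: real)\<^sup>2 \<partial>M)
          = (\<integral>\<omega>. indicator (\<Union>n. D n) \<omega> - indicator (D n) \<omega> \<partial>M)"
        by (intro Bochner_Integration.integral_cong) (auto simp: indicator_def)
      also have "\<dots> = (\<integral>\<omega>. indicator (\<Union>n. D n) \<omega> \<partial>M) - (\<integral>\<omega>. indicator (D n) \<omega> \<partial>M)"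
        using D UM by (intro Bochner_Integration.integral_diff L2_integrable indicator_L2)
      also have "\<dots> = measure M (\<Union>n. D n) - measure M (D n)"
        using D UM by simp
      finally show ?thesis .
    qed
    ultimately have lim: "(\<lambda>n. \<integral>\<omega>. (indicator (\<Union>n. D n) \<omega> - indicator (D n) \<omega> :: real)\<^sup>2 \<partial>M) \<longlonglongrightarrow> 0"
      by simp
    show ?case unfolding U
      by (rule finitary_dual_limit[where g = "\<lambda>n. indicator (D n)",
            OF indicator_L2[OF UM] indicator_L2[OF D] fin lim])
  qed
qed

text \<open>Indicators yield simple functions by linearity, and dominated convergence yields the
  rest.\<close>

lemma finitary_dual:
  assumes f: "f \<in> L2 M" "f \<in> borel_measurable (\<A> J)"
  shows "L2_dual M f \<in> finitary J"
proof -
  obtain g where "(\<forall>n. simple_function (\<A> J) (g n)) \<and> (\<forall>\<omega>\<in>space M. (\<lambda>n. g n \<omega>) \<longlonglongrightarrow> f \<omega>) \<and>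
      (\<forall>n. \<forall>\<omega>\<in>space M. dist (g n \<omega>) 0 \<le> 2 * dist (f \<omega>) 0)"
    using borel_measurable_implies_sequence_metric[OF f(2), of 0] unfolding space_\<A> by blast
  then have g: "\<And>n. simple_function (\<A> J) (g n)"
    "\<And>\<omega>. \<omega> \<in> space M \<Longrightarrow> (\<lambda>n. g n \<omega>) \<longlonglongrightarrow> f \<omega>"
    "\<And>n \<omega>. \<omega> \<in> space M \<Longrightarrow> dist (g n \<omega>) 0 \<le> 2 * dist (f \<omega>) 0"
    by blast+
  have gm: "g n \<in> borel_measurable M" for n
    using measurable_from_subalg[OF subalgebra_\<A> borel_measurable_simple_function[OF g(1)]] .
  have gL: "g n \<in> L2 M" for n
  proof -
    have "integrable M (\<lambda>\<omega>. (g n \<omega>)\<^sup>2)"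
    proof (rule Bochner_Integration.integrable_bound[of _ "\<lambda>\<omega>. 4 * (f \<omega>)\<^sup>2"])
      show "AE \<omega> in M. norm ((g n \<omega>)\<^sup>2) \<le> norm (4 * (f \<omega>)\<^sup>2)"
      proof (rule AE_I2)
        fix \<omega> assume "\<omega> \<in> space M"
        then have "\<bar>g n \<omega>\<bar>\<^sup>2 \<le> (2 * \<bar>f \<omega>\<bar>)\<^sup>2"
          using g(3)[of \<omega> n] by (intro power_mono) (simp_all add: dist_real_def)
        then show "norm ((g n \<omega>)\<^sup>2) \<le> norm (4 * (f \<omega>)\<^sup>2)" by (simp add: power_mult_distrib)
      qed
    qed (use f gm in \<open>auto simp: L2_def\<close>)
    then show ?thesis using gm by (simp add: L2_def)
  qed
  have fin: "L2_dual M (g n) \<in> finitary J" for n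
  proof -
    define A where "A v = g n -` {v} \<inter> space M" for v
    have A: "A v \<in> sets (\<A> J)" for v
      using simple_functionD(2)[OF g(1), of n "{v}"] by (simp add: A_def)
    then have AM: "A v \<in> sets M" for v using subalgebra_\<A>[of J] by (auto simp: subalgebra_def)
    have fin_range: "finite (g n ` space M)" using simple_functionD(1)[OF g(1)[of n]] by simp
    have sum: "(\<lambda>\<omega>. \<Sum>v\<in>S. v * indicator (A v) \<omega>) \<in> L2 M \<and>
        L2_dual M (\<lambda>\<omega>. \<Sum>v\<in>S. v * indicator (A v) \<omega>) = (\<Sum>v\<in>S. v *\<^sub>R L2_dual M (indicator (A v)))"
      if "finite S" for S
      using that
    proof (induction S)
      case (insert v S)
      let ?s = "\<lambda>\<omega>. \<Sum>v\<in>S. v * indicator (A v) \<omega>" and ?t = "\<lambda>\<omega>. v * indicator (A v) \<omega>"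
      have eq: "(\<lambda>\<omega>. \<Sum>v\<in>insert v S. v * indicator (A v) \<omega>) = (\<lambda>\<omega>. ?t \<omega> + ?s \<omega>)"
        by (rule ext) (rule sum.insert[OF insert.hyps])
      have s: "?s \<in> L2 M" and t: "?t \<in> L2 M" using insert.IH AM by (simp_all only: L2_cmult indicator_L2)
      have "L2_dual M (\<lambda>\<omega>. ?t \<omega> + ?s \<omega>) = L2_dual M ?t + L2_dual M ?s" using t s by (rule L2_dual_add)
      also have "L2_dual M ?t = v *\<^sub>R L2_dual M (indicator (A v))" using AM by (intro L2_dual_cmult indicator_L2)
      also have "L2_dual M ?s = (\<Sum>v\<in>S. v *\<^sub>R L2_dual M (indicator (A v)))" using insert.IH by blast
      finally show ?case unfolding eq sum.insert[OF insert.hyps] using L2_add[OF t s] by blast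
    qed (simp add: L2_dual_zero)
    have "L2_dual M (g n) = L2_dual M (\<lambda>\<omega>. \<Sum>v\<in>g n ` space M. v * indicator (A v) \<omega>)"
    proof (subst L2_dual_eq_iff)
      show "AE \<omega> in M. g n \<omega> = (\<Sum>v\<in>g n ` space M. v * indicator (A v) \<omega>)"
      proof (rule AE_I2)
        fix \<omega> assume \<omega>: "\<omega> \<in> space M"
        have "(\<Sum>v\<in>g n ` space M. v * indicator (A v) \<omega>) = (\<Sum>v\<in>g n ` space M. if v = g n \<omega> then v else 0)"
          using \<omega> by (intro sum.cong) (auto simp: A_def)
        then show "g n \<omega> = (\<Sum>v\<in>g n ` space M. v * indicator (A v) \<omega>)" using \<omega> fin_range by simp
      qed
    qed (use gL sum[OF fin_range] in auto)
    also have "\<dots> = (\<Sum>v\<in>g n ` space M. v *\<^sub>R L2_dual M (indicator (A v)))"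
      using sum[OF fin_range] by blast
    also have "\<dots> \<in> finitary J"
      using fin_range A by (intro finitary_sum finitary_scaleR finitary_indicator)
    finally show ?thesis .
  qed
  have "(\<lambda>n. \<integral>\<omega>. (f \<omega> - g n \<omega>)\<^sup>2 \<partial>M) \<longlonglongrightarrow> (\<integral>\<omega>. 0 \<partial>M)"
  \<comment> \<open>\<open>g n\<close> is at most twice \<open>f\<close> in absolute value, so
    \<open>f - g n\<close> is at most three times \<open>f\<close>, whence
    \<open>9 = 3 * 3\<close>.\<close>
  proof (rule integral_dominated_convergence[where w = "\<lambda>\<omega>. 9 * (f \<omega>)\<^sup>2"])
    show "AE \<omega> in M. (\<lambda>n. (f \<omega> - g n \<omega>)\<^sup>2) \<longlonglongrightarrow> 0"
    proof (rule AE_I2)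
      fix \<omega> assume "\<omega> \<in> space M"
      then have "(\<lambda>n. (f \<omega> - g n \<omega>)\<^sup>2) \<longlonglongrightarrow> (f \<omega> - f \<omega>)\<^sup>2"
        by (intro tendsto_intros g)
      then show "(\<lambda>n. (f \<omega> - g n \<omega>)\<^sup>2) \<longlonglongrightarrow> 0" by simp
    qed
    show "AE \<omega> in M. norm ((f \<omega> - g n \<omega>)\<^sup>2) \<le> 9 * (f \<omega>)\<^sup>2" for n
    proof (rule AE_I2)
      fix \<omega> assume "\<omega> \<in> space M"
      then have "\<bar>f \<omega> - g n \<omega>\<bar>\<^sup>2 \<le> (3 * \<bar>f \<omega>\<bar>)\<^sup>2"
        using g(3)[of \<omega> n] by (intro power_mono) (simp_all add: dist_real_def)
      then show "norm ((f \<omega> - g n \<omega>)\<^sup>2) \<le> 9 * (f \<omega>)\<^sup>2" by (simp add: power_mult_distrib)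
    qed
  qed (use f gm in \<open>auto simp: L2_def\<close>)
  then have lim: "(\<lambda>n. \<integral>\<omega>. (f \<omega> - g n \<omega>)\<^sup>2 \<partial>M) \<longlonglongrightarrow> 0" by simp
  show ?thesis by (rule finitary_dual_limit[OF f(1) gL fin lim])
qed

text \<open>An \<open>L2\<close> form of Levy's upward theorem along the finite subsets of
  \<open>J\<close>.\<close>

lemma finite_approximation:
  assumes "y \<in> L2_dual M ` L2 M" "0 < e"
  shows "\<exists>B\<subseteq>J. finite B \<and> nrm (Pr J y - Pr B y) \<le> e"
proof -
  obtain f where f: "f \<in> L2 M" "y = L2_dual M f" using assms by auto
  have "Pr J y \<in> finitary J"
    using f E_measurable[of J J f] by (simp add: finitary_dual)
  then obtain B where "B \<subseteq> J" "finite B" "nrm (Pr J y - Pr B (Pr J y)) \<le> e"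
    using assms(2) unfolding finitary_def by blast
  then show ?thesis using assms(1) by (auto simp: P_sub)
qed

section \<open>The spectral gap\<close>

lemma decorrelated_family_corr_star:
  assumes "\<And>i j. corr_star M N X i j \<le> \<epsilon> i j" "\<And>i j. 0 \<le> \<epsilon> i j" "\<And>i j. i \<noteq> j \<Longrightarrow> \<epsilon> i j < 1"
  shows "decorrelated_family (L2_dual M ` L2 M) (L2_ip M) Pr \<epsilon>"
proof
  fix i j :: 'i and K
  let ?c = "\<lambda>K. subj_corr M (\<V> i) (\<V> j) (\<A> K)"
  note least = subj_corr_least[OF prob_space_axioms subalgebra_vimage_algebra[OF X_measurable[of i]]
      subalgebra_vimage_algebra[OF X_measurable[of j]] subalgebra_\<A>]
  \<comment> \<open>A supremum of reals is sure to dominate its members only when they are bounded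
    above; correlations are at most 1.\<close>
  have "bdd_above (range ?c)" using least(1) by (intro bdd_aboveI[of _ 1]) auto
  then have "?c K \<le> corr_star M N X i j" unfolding corr_star_def by (intro cSUP_upper) auto
  then have le: "?c K \<le> \<epsilon> i j" using assms(1)[of i j] by linarith
  have c: "0 \<le> ?c K" using least(1)[of K] by simp
  have "decor {i} {j} K (1 - (?c K)\<^sup>2)" using least(2) c by (rule decor_corr_bound)
  then show "decor {i} {j} K (1 - (\<epsilon> i j)\<^sup>2)"
    by (rule decor_mono) (use le c in \<open>simp add: power_mono\<close>)
qed (use assms in auto)

text \<open>Measurability for \<open>\<A> UNIV\<close>, not just for \<open>M\<close>, makes the
  projection for \<open>UNIV\<close> fix the vector of \<open>f\<close> along
  \<open>X\<close>.\<close>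

lemma tuple_measurable:
  assumes "f \<in> borel_measurable (PiM UNIV N)"
  shows "(\<lambda>\<omega>. f (\<lambda>i. X i \<omega>)) \<in> borel_measurable (\<A> UNIV)"
proof -
  have "X i \<in> measurable (\<A> UNIV) (N i)" for i
  proof (rule measurableI)
    fix \<omega> assume "\<omega> \<in> space (\<A> UNIV)"
    then show "X i \<omega> \<in> space (N i)" using measurable_space[OF X_measurable] by simp
  next
    fix B assume "B \<in> sets (N i)"
    then have "X i -` B \<inter> space M \<in> sets (\<V> i)" by (rule in_vimage_algebra)
    then show "X i -` B \<inter> space (\<A> UNIV) \<in> sets (\<A> UNIV)"
      unfolding space_\<A> sets_\<A> by (intro sigma_sets.Basic) auto
  qed
  then have "(\<lambda>\<omega> i. X i \<omega>) \<in> measurable (\<A> UNIV) (PiM UNIV N)"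
    using measurable_space[OF X_measurable] by (intro measurable_PiM_single') auto
  then show ?thesis using assms by (rule measurable_compose)
qed

lemma integral_cond_var:
  assumes "f \<in> L2 M"
  shows "(\<integral>\<omega>. cond_var M (\<A> K) f \<omega> \<partial>M) = (nrm (L2_dual M f - Pr K (L2_dual M f)))\<^sup>2"
proof -
  interpret finite_measure_subalgebra M "\<A> K" by (rule finite_measure_subalgebra_\<A>)
  have "integrable M (\<lambda>\<omega>. (f \<omega> - E K f \<omega>)\<^sup>2)"
    using assms by (intro L2_square_integrable L2_diff) simp_all
  then show ?thesis
    unfolding cond_var_def using assms by (simp add: real_cond_exp_int(2) nrm_dual_diff)
qed

text \<open>The algebra of the empty set of sites is trivial, so conditioning on it gives the
  constant mean.\<close>

lemma variance_eq_nrm: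
  assumes "f \<in> L2 M"
  shows "variance f = (nrm (L2_dual M f - Pr {} (L2_dual M f)))\<^sup>2"
proof -
  interpret finite_measure_subalgebra M "\<A> {}" by (rule finite_measure_subalgebra_\<A>)
  have "AE \<omega> in M. E {} f \<omega> = expectation f"
  proof (rule real_cond_exp_charact)
    fix A assume "A \<in> sets (\<A> {})"
    then have "A = {} \<or> A = space M" by (simp add: sets_\<A> sigma_sets_empty_eq)
    then show "(\<integral>\<omega>\<in>A. f \<omega> \<partial>M) = (\<integral>\<omega>\<in>A. expectation f \<partial>M)"
    proof
      assume "A = {}"
      then show ?thesis by (simp add: set_lebesgue_integral_def)
    qed (use L2_integrable[OF assms] in \<open>simp add: set_integral_space prob_space\<close>)
  qed (use L2_integrable[OF assms] in auto)
  then have "L2_dual M (E {} f) = L2_dual M (\<lambda>_. expectation f)"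
    using assms by (subst L2_dual_eq_iff) auto
  then show ?thesis using assms by (simp add: nrm_dual_diff)
qed

end

theorem theorem4p2p13:
  fixes M :: "'a measure"
    and N :: "int ^ 'n \<Rightarrow> 'b measure"
    and X :: "int ^ 'n \<Rightarrow> 'a \<Rightarrow> 'b"
    and Pr :: "(int ^ 'n \<Rightarrow> 'b) measure"
    and \<epsilon> :: "int ^ 'n \<Rightarrow> real"
  assumes "prob_space M"
    and "\<And>i. X i \<in> measurable M (N i)"
    and "Pr = distr M (PiM UNIV N) (\<lambda>\<omega> i. X i \<omega>)"
    and "\<And>z. \<epsilon> z \<in> {0..1}"
    and "\<And>z. \<epsilon> (- z) = \<epsilon> z"
    and "\<And>z. z \<noteq> 0 \<Longrightarrow> \<epsilon> z < 1"
    and "\<And>i j. corr_star M N X i j \<le> \<epsilon> (j - i)"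
    and "\<epsilon> summable_on UNIV"
  shows "\<exists>c>0. \<forall>f \<in> borel_measurable Pr. integrable Pr (\<lambda>x. (f x)\<^sup>2) \<longrightarrow>
           glauber_energy M N X f \<ge> ennreal (c * prob_space.variance Pr f)"
proof -
  interpret random_system M N X
    using assms(1,2) by (simp add: random_system_def random_system_axioms_def)
  define \<epsilon>' where "\<epsilon>' i j = \<epsilon> (j - i)" for i j
  have nonneg: "0 \<le> \<epsilon> z" for z using assms(4)[of z] by simp
  interpret decorrelated_family "L2_dual M ` L2 M" "L2_ip M" "\<lambda>K. L2_proj M (\<A> K)" \<epsilon>'
  proof (rule decorrelated_family_corr_star)
    fix i j
    show "corr_star M N X i j \<le> \<epsilon>' i j" unfolding \<epsilon>'_def by (rule assms(7))
    show "0 \<le> \<epsilon>' i j" unfolding \<epsilon>'_def by (rule nonneg)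
    show "\<epsilon>' i j < 1" if "i \<noteq> j" unfolding \<epsilon>'_def using that by (intro assms(6)) simp
  qed
  have "\<forall>z. z \<noteq> 0 \<longrightarrow> \<epsilon> z < 1" using assms(6) by simp
  from lattice_colouring[OF nonneg this assms(8)]
  obtain col :: "int ^ 'n \<Rightarrow> int ^ 'n" and \<eta> r where col: "finite (range col)" "\<eta> + r < 1" "0 \<le> r"
    and same: "\<forall>i S. finite S \<longrightarrow> i \<notin> S \<longrightarrow> col ` S \<subseteq> {col i} \<longrightarrow> (\<Sum>j\<in>S. \<epsilon> (j - i)) \<le> \<eta>"
    and diff: "\<forall>i c S. finite S \<longrightarrow> c \<noteq> col i \<longrightarrow> col ` S \<subseteq> {c} \<longrightarrow> (\<Sum>j\<in>S. \<epsilon> (j - i)) \<le> r"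
    by (elim exE conjE)
  have "\<exists>C\<ge>0. \<forall>S. finite S \<longrightarrow> gap_bound UNIV S C"
  proof (rule uniform_gap_bound[of col \<eta> r])
    fix i c and S :: "(int ^ 'n) set" assume S: "finite S"
    show "(\<Sum>j\<in>S. \<epsilon>' i j) \<le> \<eta>" if "i \<notin> S" "col ` S \<subseteq> {col i}"
      unfolding \<epsilon>'_def using same[rule_format, OF S that] .
    show "(\<Sum>j\<in>S. \<epsilon>' i j) \<le> r" if "c \<noteq> col i" "col ` S \<subseteq> {c}"
      unfolding \<epsilon>'_def using diff[rule_format, OF S that] .
  qed (use col in simp_all)
  then obtain C where C: "0 \<le> C" "\<And>S. finite S \<Longrightarrow> gap_bound UNIV S C" by blast
  have small: "\<exists>F. finite F \<and> (\<forall>B. finite B \<longrightarrow> B \<inter> F = {} \<longrightarrow> (\<Sum>j\<in>B. \<epsilon>' i j) \<le> e)" if e: "0 < e" for i e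
  proof -
    obtain F where F: "finite F" "\<And>B. finite B \<Longrightarrow> B \<inter> F = {} \<Longrightarrow> sum \<epsilon> B \<le> e"
      using summable_on_small_tail[OF assms(8) nonneg e] by blast
    have "(\<Sum>j\<in>B. \<epsilon>' i j) \<le> e" if B: "finite B" "B \<inter> (\<lambda>z. z + i) ` F = {}" for B
    proof -
      have "(\<Sum>j\<in>B. \<epsilon>' i j) = sum \<epsilon> ((\<lambda>j. j - i) ` B)"
        by (subst sum.reindex) (auto simp: inj_on_def \<epsilon>'_def)
      also have "\<dots> \<le> e"
      proof (rule F(2))
        show "(\<lambda>j. j - i) ` B \<inter> F = {}"
        proof (rule ccontr)
          assume "(\<lambda>j. j - i) ` B \<inter> F \<noteq> {}"
          then obtain j where "j \<in> B" "j - i \<in> F" by blast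
          then have "j \<in> (\<lambda>z. z + i) ` F" by (intro image_eqI[of _ _ "j - i"]) simp_all
          then show False using B(2) \<open>j \<in> B\<close> by blast
        qed
      qed (use B in simp)
      finally show ?thesis .
    qed
    then show ?thesis using F(1) by (intro exI[of _ "(\<lambda>z. z + i) ` F"]) blast
  qed
  have tuple: "(\<lambda>\<omega> i. X i \<omega>) \<in> measurable M (PiM UNIV N)"
    using assms(2) measurable_space[OF assms(2)] by (intro measurable_PiM_single') auto
  \<comment> \<open>\<open>C\<close> may be 0, hence \<open>C + 1\<close> in the witness.\<close>
  have "ennreal (1 / (C + 1) * prob_space.variance Pr f) \<le> glauber_energy M N X f"
    if f: "f \<in> borel_measurable Pr" "integrable Pr (\<lambda>x. (f x)\<^sup>2)" for f
  proof (cases "glauber_energy M N X f = \<infinity>")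
    case False
    have fN: "f \<in> borel_measurable (PiM UNIV N)" using f(1) by (simp add: assms(3))
    define g where "g = (\<lambda>\<omega>. f (\<lambda>i. X i \<omega>))"
    have g_meas: "g \<in> borel_measurable (\<A> UNIV)" unfolding g_def by (rule tuple_measurable[OF fN])
    have gL: "g \<in> L2 M"
      using f(2) measurable_from_subalg[OF subalgebra_\<A> g_meas] fN tuple
      by (simp add: L2_def g_def assms(3) integrable_distr_eq)
    let ?x = "L2_dual M g"
    have x: "?x \<in> L2_dual M ` L2 M" "L2_proj M (\<A> UNIV) ?x = ?x"
      using gL g_meas by (simp_all add: dual_E_id)
    have var: "prob_space.variance Pr f = (nrm (L2_proj M (\<A> UNIV) ?x - L2_proj M (\<A> {}) ?x))\<^sup>2"
      using variance_eq_nrm[OF gL] fN tuple x(2) by (simp add: g_def assms(3) integral_distr)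
    define T where "T = enn2real (glauber_energy M N X f)"
    have T: "glauber_energy M N X f = ennreal T" "0 \<le> T"
      using False by (simp_all add: T_def ennreal_enn2real_if)
    have en: "(\<Sum>i\<in>S. (energy UNIV i ?x)\<^sup>2) \<le> T" if S: "finite S" for S
    proof -
      have "ennreal (\<Sum>i\<in>S. (energy UNIV i ?x)\<^sup>2) = (\<Sum>i\<in>S. ennreal ((energy UNIV i ?x)\<^sup>2))"
        by (rule sum_ennreal[symmetric]) simp
      also have "\<dots> = (\<Sum>i\<in>S. ennreal (\<integral>\<omega>. cond_var M (\<A> (UNIV - {i})) g \<omega> \<partial>M))"
        unfolding integral_cond_var[OF gL] energy_def x(2) ..
      also have "\<dots> \<le> glauber_energy M N X f"
        unfolding glauber_energy_def g_def[symmetric]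
        by (subst nonneg_infsum_complete) (use S in \<open>auto intro: SUP_upper\<close>)
      finally show ?thesis using T by (simp add: ennreal_le_iff)
    qed
    have "prob_space.variance Pr f \<le> C * T"
      unfolding var using C small x(1) en
      by (intro Poincare_inequality finite_approximation) auto
    also have "\<dots> \<le> (C + 1) * T" using T(2) by (simp add: algebra_simps)
    finally have "1 / (C + 1) * prob_space.variance Pr f \<le> T" using C(1) by (simp add: field_simps)
    then show ?thesis unfolding T(1) by (rule ennreal_leI)
  qed simp
  moreover have "0 < 1 / (C + 1)" using C by simp
  ultimately show ?thesis by blast
qed

end
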